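(* Every kite $K_{I,J}^{\lambda,\rho}(\mathbf A)$ of a basic pseudo hoop $\mathbf A$ (where $I,J$ are sets with $|J|\le|I|$ and $\lambda,\rho:J\to I$ are injections) is a subdirect product of subdirectly irreducible kites, i.e. of subdirectly irreducible algebras each of the form $K_{I',J'}^{\lambda',\rho'}(\mathbf A')$ for some basic pseudo hoop $\mathbf A'$, sets $I',J'$ and injections $\lambda',\rho':J'\to I'$.
   Context: SUBDIRECT PRODUCT. $B$ is a subdirect product of $(B_s)_{s\in S}$ if there is an injective homomorphism $B\to\prod_{s\in S}B_s$ whose composition with each projection onto $B_s$ is surjective. PSEUDO HOOPS. A pseudo hoop is an algebra $\mathbf A=(A;\cdot,\backslash,/,1)$ of type $\langle 2,2,2,0\rangle$ such that for all $a,b,c\in A$: (i) $a\cdot 1=1\cdot a=a$; (ii) $a\backslash a=1=a/a$; (iii) $c/(a\cdot b)=(c/b)/a$; (iv) $(a\cdot b)\backslash c=b\backslash(a\backslash c)$; (v) $(b/a)\cdot a=(a/b)\cdot b=a\cdot(a\backslash b)=b\cdot(b\backslash a)$. We write $ab$ for $a\cdot b$; $\cdot$ binds stronger than $\backslash,/$, which bind stronger than $\wedge,\vee$. The order is $a\le b$ iff $a\backslash b=1$ (iff $b/a=1$); $1$ is the top element, and $(A;\cdot,1)$ is a residuated monoid: $xy\le z$ iff $y\le x\backslash z$ iff $x\le z/y$. A pseudo hoop is basic if for all $a,b,c$: $c/(b/a)\le c/(c/(a/b))$ and $(a\backslash b)\backslash c\le((b\backslash a)\backslash c)\backslash c$.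 A basic pseudo hoop is a (distributive) lattice under $\le$. KITES. Let $\overline A=\{\bar a: a\in A\}$ be a disjoint copy of $A$ ($\bar a=\bar b$ iff $a=b$). The kite (kite pseudo BL-algebra) $K_{I,J}^{\lambda,\rho}(\mathbf A)=((\overline A)^J\uplus A^I;\cdot,\backslash,/,\wedge,\vee,0,1)$ has as universe the disjoint union $(\overline A)^J\uplus A^I$. Order: $A^I$ is ordered coordinatewise; $\langle\bar f_j:j\in J\rangle\le\langle\bar g_j:j\in J\rangle$ iff $g_j\le f_j$ for all $j\in J$; and $x\le y$ for all $x\in(\overline A)^J$, $y\in A^I$. This is a bounded lattice with bottom $0=\langle\bar 1:j\in J\rangle$ and top $1=\langle 1:i\in I\rangle$; $\wedge,\vee$ are its lattice operations. Multiplication: $\langle a_i\rangle\cdot\langle b_i\rangle=\langle a_ib_i\rangle$; $\langle a_i\rangle\cdot\langle\bar f_j\rangle=\langle\overline{f_j/a_{\lambda(j)}}\rangle$; $\langle\bar f_j\rangle\cdot\langle a_i\rangle=\langle\overline{a_{\rho(j)}\backslash f_j}\rangle$; $\langle\bar f_j\rangle\cdot\langle\bar g_j\rangle=0$. Divisions: $\langle a_i\rangle\backslash\langle b_i\rangle=\langle a_i\backslash b_i\rangle$; $\langle b_i\rangle/\langle a_i\rangle=\langle b_i/a_i\rangle$; $\langle a_i\rangle\backslash\langle\bar f_j\rangle=\langle\overline{f_ja_{\lambda(j)}}\rangle$; $\langle\bar f_j\rangle/\langle a_i\rangle=\langle\overline{a_{\rho(j)}f_j}\rangle$; $\langle\bar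 f_j\rangle\backslash\langle\bar g_j\rangle=\langle a_i\rangle$ with $a_i=f_{\rho^{-1}(i)}/g_{\rho^{-1}(i)}$ if $i\in\rho(J)$ and $a_i=1$ otherwise; $\langle\bar g_j\rangle/\langle\bar f_j\rangle=\langle b_i\rangle$ with $b_i=g_{\lambda^{-1}(i)}\backslash f_{\lambda^{-1}(i)}$ if $i\in\lambda(J)$ and $b_i=1$ otherwise; $\langle a_i\rangle/\langle\bar f_j\rangle=1=\langle\bar f_j\rangle\backslash\langle a_i\rangle$. Homomorphisms of kites preserve all of $\cdot,\backslash,/,\wedge,\vee,0,1$. FILTERS AND SUBDIRECT IRREDUCIBILITY. In a pseudo hoop or a kite $B$, a filter is a nonempty subset closed under $\cdot$ and upward closed. A filter $F$ is normal if for all $a,b\in B$: $b/a\in F$ iff $a\backslash b\in F$. Congruences correspond bijectively to normal filters, and $B$ is subdirectly irreducible iff it is trivial (one-element) or has a least normal filter among the normal filters $F\ne\{1\}$. *)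

theory Defs
  imports "HOL-Algebra.Group" "HOL-Library.FuncSet" "HOL-Library.Equipollence"
begin

section \<open>Pseudo hoops\<close>

record 'a pseudo_hoop = "'a monoid" +
  ldiv :: "'a \<Rightarrow> 'a \<Rightarrow> 'a" (infixl \<open>\<setminus>\<index>\<close> 65)
  rdiv :: "'a \<Rightarrow> 'a \<Rightarrow> 'a" (infixl \<open>\<oslash>\<index>\<close> 65)

definition hoop_le :: "('a, 'm) pseudo_hoop_scheme \<Rightarrow> 'a \<Rightarrow> 'a \<Rightarrow> bool"  (infix \<open>\<preceq>\<index>\<close> 50)
  where "a \<preceq>\<^bsub>A\<^esub> b \<longleftrightarrow> a \<setminus>\<^bsub>A\<^esub> b = \<one>\<^bsub>A\<^esub>"

locale pseudo_hoop =
  fixes A :: "('a, 'm) pseudo_hoop_scheme" (structure)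
  assumes one_closed: "\<one> \<in> carrier A"
    and mult_closed: "\<lbrakk>a \<in> carrier A; b \<in> carrier A\<rbrakk> \<Longrightarrow> a \<otimes> b \<in> carrier A"
    and ldiv_closed: "\<lbrakk>a \<in> carrier A; b \<in> carrier A\<rbrakk> \<Longrightarrow> a \<setminus> b \<in> carrier A"
    and rdiv_closed: "\<lbrakk>a \<in> carrier A; b \<in> carrier A\<rbrakk> \<Longrightarrow> a \<oslash> b \<in> carrier A"
    and mult_one: "a \<in> carrier A \<Longrightarrow> a \<otimes> \<one> = a"
    and one_mult: "a \<in> carrier A \<Longrightarrow> \<one> \<otimes> a = a"
    and ldiv_self: "a \<in> carrier A \<Longrightarrow> a \<setminus> a = \<one>"
    and rdiv_self: "a \<in> carrier A \<Longrightarrow> a \<oslash> a = \<one>"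
    and rdiv_mult: "\<lbrakk>a \<in> carrier A; b \<in> carrier A; c \<in> carrier A\<rbrakk>
      \<Longrightarrow> c \<oslash> (a \<otimes> b) = (c \<oslash> b) \<oslash> a"
    and mult_ldiv: "\<lbrakk>a \<in> carrier A; b \<in> carrier A; c \<in> carrier A\<rbrakk>
      \<Longrightarrow> (a \<otimes> b) \<setminus> c = b \<setminus> (a \<setminus> c)"
    and divisible_rdiv: "\<lbrakk>a \<in> carrier A; b \<in> carrier A\<rbrakk> \<Longrightarrow> (b \<oslash> a) \<otimes> a = (a \<oslash> b) \<otimes> b"
    and divisible_rdiv_ldiv: "\<lbrakk>a \<in> carrier A; b \<in> carrier A\<rbrakk> \<Longrightarrow> (a \<oslash> b) \<otimes> b = a \<otimes> (a \<setminus> b)"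
    and divisible_ldiv: "\<lbrakk>a \<in> carrier A; b \<in> carrier A\<rbrakk> \<Longrightarrow> a \<otimes> (a \<setminus> b) = b \<otimes> (b \<setminus> a)"

context pseudo_hoop
begin

lemma rdiv_one: "a \<in> carrier A \<Longrightarrow> a \<oslash> \<one> = a"
  by (metis divisible_rdiv mult_one one_mult rdiv_closed rdiv_mult rdiv_self one_closed)

lemma ldiv_one: "a \<in> carrier A \<Longrightarrow> \<one> \<setminus> a = a"
  by (metis divisible_rdiv_ldiv divisible_rdiv mult_one one_mult rdiv_closed ldiv_closed
      rdiv_one one_closed)

lemma one_top:
  assumes "a \<in> carrier A"
  shows "a \<setminus> \<one> = \<one>"
  using assms one_closed rdiv_one ldiv_one
  by (metis (no_types, lifting) divisible_ldiv ldiv_closed ldiv_self mult_ldiv)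

lemma one_top':
  assumes "a \<in> carrier A"
  shows "\<one> \<oslash> a = \<one>"
  using assms one_closed rdiv_one ldiv_one
  by (metis (no_types, lifting) divisible_rdiv rdiv_closed rdiv_self rdiv_mult)

lemma hoop_le_iff_rdiv:
  assumes a: "a \<in> carrier A" and b: "b \<in> carrier A"
  shows "a \<preceq> b \<longleftrightarrow> b \<oslash> a = \<one>"
proof
  assume "a \<preceq> b"
  then have "a = (a \<oslash> b) \<otimes> b"
    using a b by (simp add: hoop_le_def divisible_rdiv_ldiv mult_one)
  then have "b \<oslash> a = (b \<oslash> b) \<oslash> (a \<oslash> b)"
    using a b by (metis rdiv_mult rdiv_closed)
  then show "b \<oslash> a = \<one>"
    using a b by (simp add: rdiv_self one_top' rdiv_closed)
next
  assume "b \<oslash> a = \<one>"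
  then have "a = b \<otimes> (b \<setminus> a)"
    using a b by (metis divisible_rdiv divisible_rdiv_ldiv divisible_ldiv one_mult)
  then have "a \<setminus> b = (b \<setminus> a) \<setminus> (b \<setminus> b)"
    using a b by (metis mult_ldiv ldiv_closed)
  then show "a \<preceq> b"
    using a b by (simp add: hoop_le_def ldiv_self one_top ldiv_closed)
qed

end

locale basic_pseudo_hoop = pseudo_hoop +
  assumes basic_rdiv: "\<lbrakk>a \<in> carrier A; b \<in> carrier A; c \<in> carrier A\<rbrakk>
      \<Longrightarrow> c \<oslash> (b \<oslash> a) \<preceq> c \<oslash> (c \<oslash> (a \<oslash> b))"
    and basic_ldiv: "\<lbrakk>a \<in> carrier A; b \<in> carrier A; c \<in> carrier A\<rbrakk>
      \<Longrightarrow> (a \<setminus> b) \<setminus> c \<preceq> ((b \<setminus> a) \<setminus> c) \<setminus> c"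

section \<open>Kites\<close>

record 'a pseudo_bl = "'a pseudo_hoop" +
  bl_meet :: "'a \<Rightarrow> 'a \<Rightarrow> 'a"
  bl_join :: "'a \<Rightarrow> 'a \<Rightarrow> 'a"
  bl_zero :: 'a

text \<open>
  An element of the disjoint union of the barred copy of \<open>A\<^sup>J\<close> and of \<open>A\<^sup>I\<close> is
  \<open>Inl f\<close> (the barred family \<open>f\<close>) or \<open>Inr a\<close>, where families are extensional functions.
\<close>

type_synonym ('a, 'i, 'j) kite_elem = "('j \<Rightarrow> 'a) + ('i \<Rightarrow> 'a)"

definition kite_carrier ::
  "'i set \<Rightarrow> 'j set \<Rightarrow> ('a, 'm) pseudo_hoop_scheme \<Rightarrow> ('a, 'i, 'j) kite_elem set"
  where "kite_carrier I J A = (J \<rightarrow>\<^sub>E carrier A) <+> (I \<rightarrow>\<^sub>E carrier A)"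

fun kite_le ::
  "'i set \<Rightarrow> 'j set \<Rightarrow> ('a, 'm) pseudo_hoop_scheme
    \<Rightarrow> ('a, 'i, 'j) kite_elem \<Rightarrow> ('a, 'i, 'j) kite_elem \<Rightarrow> bool"
  where
    "kite_le I J A (Inr a) (Inr b) \<longleftrightarrow> (\<forall>i\<in>I. a i \<preceq>\<^bsub>A\<^esub> b i)"
  | "kite_le I J A (Inl f) (Inl g) \<longleftrightarrow> (\<forall>j\<in>J. g j \<preceq>\<^bsub>A\<^esub> f j)"
  | "kite_le I J A (Inl f) (Inr a) \<longleftrightarrow> True"
  | "kite_le I J A (Inr a) (Inl f) \<longleftrightarrow> False"

definition kite_zero ::
  "'j set \<Rightarrow> ('a, 'm) pseudo_hoop_scheme \<Rightarrow> ('a, 'i, 'j) kite_elem"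
  where "kite_zero J A = Inl (\<lambda>j\<in>J. \<one>\<^bsub>A\<^esub>)"

definition kite_one ::
  "'i set \<Rightarrow> ('a, 'm) pseudo_hoop_scheme \<Rightarrow> ('a, 'i, 'j) kite_elem"
  where "kite_one I A = Inr (\<lambda>i\<in>I. \<one>\<^bsub>A\<^esub>)"

fun kite_mult ::
  "'i set \<Rightarrow> 'j set \<Rightarrow> ('j \<Rightarrow> 'i) \<Rightarrow> ('j \<Rightarrow> 'i) \<Rightarrow> ('a, 'm) pseudo_hoop_scheme
    \<Rightarrow> ('a, 'i, 'j) kite_elem \<Rightarrow> ('a, 'i, 'j) kite_elem \<Rightarrow> ('a, 'i, 'j) kite_elem"
  where
    "kite_mult I J l r A (Inr a) (Inr b) = Inr (\<lambda>i\<in>I. a i \<otimes>\<^bsub>A\<^esub> b i)"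
  | "kite_mult I J l r A (Inr a) (Inl f) = Inl (\<lambda>j\<in>J. f j \<oslash>\<^bsub>A\<^esub> a (l j))"
  | "kite_mult I J l r A (Inl f) (Inr a) = Inl (\<lambda>j\<in>J. a (r j) \<setminus>\<^bsub>A\<^esub> f j)"
  | "kite_mult I J l r A (Inl f) (Inl g) = kite_zero J A"

fun kite_ldiv ::
  "'i set \<Rightarrow> 'j set \<Rightarrow> ('j \<Rightarrow> 'i) \<Rightarrow> ('j \<Rightarrow> 'i) \<Rightarrow> ('a, 'm) pseudo_hoop_scheme
    \<Rightarrow> ('a, 'i, 'j) kite_elem \<Rightarrow> ('a, 'i, 'j) kite_elem \<Rightarrow> ('a, 'i, 'j) kite_elem"
  where
    "kite_ldiv I J l r A (Inr a) (Inr b) = Inr (\<lambda>i\<in>I. a i \<setminus>\<^bsub>A\<^esub> b i)"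
  | "kite_ldiv I J l r A (Inr a) (Inl f) = Inl (\<lambda>j\<in>J. f j \<otimes>\<^bsub>A\<^esub> a (l j))"
  | "kite_ldiv I J l r A (Inl f) (Inl g) =
       Inr (\<lambda>i\<in>I. if i \<in> r ` J
                  then f (inv_into J r i) \<oslash>\<^bsub>A\<^esub> g (inv_into J r i) else \<one>\<^bsub>A\<^esub>)"
  | "kite_ldiv I J l r A (Inl f) (Inr a) = kite_one I A"

text \<open>\<open>kite_rdiv I J l r A y x\<close> is \<open>y / x\<close>: the dividend comes first.\<close>

fun kite_rdiv ::
  "'i set \<Rightarrow> 'j set \<Rightarrow> ('j \<Rightarrow> 'i) \<Rightarrow> ('j \<Rightarrow> 'i) \<Rightarrow> ('a, 'm) pseudo_hoop_scheme
    \<Rightarrow> ('a, 'i, 'j) kite_elem \<Rightarrow> ('a, 'i, 'j) kite_elem \<Rightarrow> ('a, 'i, 'j) kite_elem"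
  where
    "kite_rdiv I J l r A (Inr b) (Inr a) = Inr (\<lambda>i\<in>I. b i \<oslash>\<^bsub>A\<^esub> a i)"
  | "kite_rdiv I J l r A (Inl f) (Inr a) = Inl (\<lambda>j\<in>J. a (r j) \<otimes>\<^bsub>A\<^esub> f j)"
  | "kite_rdiv I J l r A (Inl g) (Inl f) =
       Inr (\<lambda>i\<in>I. if i \<in> l ` J
                  then g (inv_into J l i) \<setminus>\<^bsub>A\<^esub> f (inv_into J l i) else \<one>\<^bsub>A\<^esub>)"
  | "kite_rdiv I J l r A (Inr a) (Inl f) = kite_one I A"

definition is_glb :: "('b \<Rightarrow> 'b \<Rightarrow> bool) \<Rightarrow> 'b set \<Rightarrow> 'b \<Rightarrow> 'b \<Rightarrow> 'b \<Rightarrow> bool"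
  where "is_glb R U x y z \<longleftrightarrow>
    z \<in> U \<and> R z x \<and> R z y \<and> (\<forall>w\<in>U. R w x \<and> R w y \<longrightarrow> R w z)"

definition is_lub :: "('b \<Rightarrow> 'b \<Rightarrow> bool) \<Rightarrow> 'b set \<Rightarrow> 'b \<Rightarrow> 'b \<Rightarrow> 'b \<Rightarrow> bool"
  where "is_lub R U x y z \<longleftrightarrow>
    z \<in> U \<and> R x z \<and> R y z \<and> (\<forall>w\<in>U. R x w \<and> R y w \<longrightarrow> R z w)"

definition kite ::
  "'i set \<Rightarrow> 'j set \<Rightarrow> ('j \<Rightarrow> 'i) \<Rightarrow> ('j \<Rightarrow> 'i) \<Rightarrow> ('a, 'm) pseudo_hoop_scheme
    \<Rightarrow> ('a, 'i, 'j) kite_elem pseudo_bl"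
  where "kite I J l r A =
    \<lparr>carrier = kite_carrier I J A,
     monoid.mult = kite_mult I J l r A,
     one = kite_one I A,
     ldiv = kite_ldiv I J l r A,
     rdiv = kite_rdiv I J l r A,
     bl_meet = (\<lambda>x y. THE z. is_glb (kite_le I J A) (kite_carrier I J A) x y z),
     bl_join = (\<lambda>x y. THE z. is_lub (kite_le I J A) (kite_carrier I J A) x y z),
     bl_zero = kite_zero J A\<rparr>"

definition is_kite :: "('a, 'i, 'j) kite_elem pseudo_bl \<Rightarrow> bool"
  where "is_kite K \<longleftrightarrow>
    (\<exists>(A :: 'a pseudo_hoop) I J l r. basic_pseudo_hoop A \<and>
       l \<in> J \<rightarrow> I \<and> inj_on l J \<and> r \<in> J \<rightarrow> I \<and> inj_on r J \<and> K = kite I J l r A)"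

text \<open>The order of a kite is the one induced by its divisions, as in pseudo hoops.\<close>

lemma (in pseudo_hoop) kite_le_iff:
  fixes I :: "'i set" and J :: "'j set"
  assumes x: "x \<in> carrier (kite I J l r A)" and y: "y \<in> carrier (kite I J l r A)"
    and r: "r \<in> J \<rightarrow> I" "inj_on r J"
  shows "kite_le I J A x y \<longleftrightarrow> x \<preceq>\<^bsub>kite I J l r A\<^esub> y"
proof -
  have res: "(\<lambda>i\<in>I. f i) = (\<lambda>i\<in>I. g i) \<longleftrightarrow> (\<forall>i\<in>I. f i = g i)" for f g :: "'i \<Rightarrow> 'a"
    by (metis restrict_apply' restrict_ext)
  show ?thesis
  proof (cases x; cases y)
    fix f g assume xy: "x = Inl f" "y = Inl g"
    have fg: "f \<in> J \<rightarrow>\<^sub>E carrier A" "g \<in> J \<rightarrow>\<^sub>E carrier A"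
      using x y xy by (auto simp: kite_def kite_carrier_def)
    have "g j \<preceq> f j \<longleftrightarrow> f j \<oslash> g j = \<one>" if "j \<in> J" for j
      using fg that by (intro hoop_le_iff_rdiv) auto
    then show ?thesis
      using xy r fg by (auto simp: kite_def hoop_le_def kite_one_def res)
  qed (use x y in \<open>auto simp: kite_def hoop_le_def kite_one_def res\<close>)
qed

section \<open>Filters and subdirect irreducibility\<close>

definition hoop_filter :: "('a, 'm) pseudo_hoop_scheme \<Rightarrow> 'a set \<Rightarrow> bool"
  where "hoop_filter B F \<longleftrightarrow>
    F \<subseteq> carrier B \<and> F \<noteq> {} \<and>
    (\<forall>x\<in>F. \<forall>y\<in>F. x \<otimes>\<^bsub>B\<^esub> y \<in> F) \<and>
    (\<forall>x\<in>F. \<forall>y\<in>carrier B. x \<preceq>\<^bsub>B\<^esub> y \<longrightarrow> y \<in> F)"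

definition normal_filter :: "('a, 'm) pseudo_hoop_scheme \<Rightarrow> 'a set \<Rightarrow> bool"
  where "normal_filter B F \<longleftrightarrow>
    hoop_filter B F \<and>
    (\<forall>a\<in>carrier B. \<forall>b\<in>carrier B. b \<oslash>\<^bsub>B\<^esub> a \<in> F \<longleftrightarrow> a \<setminus>\<^bsub>B\<^esub> b \<in> F)"

definition subdirectly_irreducible :: "('a, 'm) pseudo_hoop_scheme \<Rightarrow> bool"
  where "subdirectly_irreducible B \<longleftrightarrow>
    (\<exists>x. carrier B = {x}) \<or>
    (\<exists>F. normal_filter B F \<and> F \<noteq> {\<one>\<^bsub>B\<^esub>} \<and>
         (\<forall>G. normal_filter B G \<and> G \<noteq> {\<one>\<^bsub>B\<^esub>} \<longrightarrow> F \<subseteq> G))"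

section \<open>Subdirect products\<close>

definition bl_hom :: "('a, 'm) pseudo_bl_scheme \<Rightarrow> ('b, 'n) pseudo_bl_scheme \<Rightarrow> ('a \<Rightarrow> 'b) set"
  where "bl_hom B C = {h \<in> carrier B \<rightarrow> carrier C.
    (\<forall>x\<in>carrier B. \<forall>y\<in>carrier B.
       h (x \<otimes>\<^bsub>B\<^esub> y) = h x \<otimes>\<^bsub>C\<^esub> h y \<and>
       h (x \<setminus>\<^bsub>B\<^esub> y) = h x \<setminus>\<^bsub>C\<^esub> h y \<and>
       h (x \<oslash>\<^bsub>B\<^esub> y) = h x \<oslash>\<^bsub>C\<^esub> h y \<and>
       h (bl_meet B x y) = bl_meet C (h x) (h y) \<and>
       h (bl_join B x y) = bl_join C (h x) (h y)) \<and>
    h (bl_zero B) = bl_zero C \<and> h \<one>\<^bsub>B\<^esub> = \<one>\<^bsub>C\<^esub>}"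

definition bl_product :: "'s set \<Rightarrow> ('s \<Rightarrow> ('b, 'n) pseudo_bl_scheme) \<Rightarrow> ('s \<Rightarrow> 'b) pseudo_bl"
  where "bl_product S B =
    \<lparr>carrier = (\<Pi>\<^sub>E s\<in>S. carrier (B s)),
     monoid.mult = (\<lambda>x y. \<lambda>s\<in>S. x s \<otimes>\<^bsub>B s\<^esub> y s),
     one = (\<lambda>s\<in>S. \<one>\<^bsub>B s\<^esub>),
     ldiv = (\<lambda>x y. \<lambda>s\<in>S. x s \<setminus>\<^bsub>B s\<^esub> y s),
     rdiv = (\<lambda>x y. \<lambda>s\<in>S. x s \<oslash>\<^bsub>B s\<^esub> y s),
     bl_meet = (\<lambda>x y. \<lambda>s\<in>S. bl_meet (B s) (x s) (y s)),
     bl_join = (\<lambda>x y. \<lambda>s\<in>S. bl_join (B s) (x s) (y s)),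
     bl_zero = (\<lambda>s\<in>S. bl_zero (B s))\<rparr>"

definition subdirect_product ::
  "('a, 'm) pseudo_bl_scheme \<Rightarrow> 's set \<Rightarrow> ('s \<Rightarrow> ('b, 'n) pseudo_bl_scheme) \<Rightarrow> bool"
  where "subdirect_product B S Bs \<longleftrightarrow>
    (\<exists>h \<in> bl_hom B (bl_product S Bs). inj_on h (carrier B) \<and>
       (\<forall>s\<in>S. (\<lambda>x. h x s) ` carrier B = carrier (Bs s)))"

end

(*
  Every basic pseudo hoop A is separated by its quotients A/F, where F is a normal filter maximal
  among those avoiding some element c; the class of c then lies in every nontrivial normal filter
  of A/F.  Likewise I splits into connected components under the relation identifying l(j) with
  r(j).  Both decompositions are inherited by kites coordinatewise, so the kite embeds
  subdirectly into the kites of A/F over the components C.  Such a kite is subdirectly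
  irreducible: let d_i(b) be b at coordinate i and 1 elsewhere.  For a normal filter G of the
  kite, the b with d_i(b) in G form a normal filter of A/F, and normality of G applied to barred
  families makes it the same filter for i = l(j) and i = r(j), hence for all i in C.
*)

theory Submission
  imports Defs
begin

section \<open>Arithmetic of pseudo hoops\<close>

text \<open>By divisibility the expression is symmetric in \<open>a\<close> and \<open>b\<close>; it
  is their infimum in every pseudo hoop.\<close>

definition hoop_meet :: "('a, 'm) pseudo_hoop_scheme \<Rightarrow> 'a \<Rightarrow> 'a \<Rightarrow> 'a"
  where "hoop_meet A a b = a \<otimes>\<^bsub>A\<^esub> (a \<setminus>\<^bsub>A\<^esub> b)"

text \<open>An upper bound of \<open>a\<close> and \<open>b\<close> in every pseudo hoop, and the
  least one once basicness is available. The reversed order on barred families turns such joins into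
  meets of the kite.\<close>

definition hoop_join :: "('a, 'm) pseudo_hoop_scheme \<Rightarrow> 'a \<Rightarrow> 'a \<Rightarrow> 'a"
  where "hoop_join A a b = hoop_meet A (b \<oslash>\<^bsub>A\<^esub> (a \<setminus>\<^bsub>A\<^esub> b)) (a \<oslash>\<^bsub>A\<^esub> (b \<setminus>\<^bsub>A\<^esub> a))"

context pseudo_hoop
begin

lemmas hoop_closed = one_closed mult_closed ldiv_closed rdiv_closed

section \<open>Order and residuation from the equational axioms\<close>

lemma hoop_le_refl: "a \<in> carrier A \<Longrightarrow> a \<preceq> a"
  by (simp add: hoop_le_def ldiv_self)

lemma hoop_le_antisym:
  assumes "a \<preceq> b" "b \<preceq> a" "a \<in> carrier A" "b \<in> carrier A"
  shows "a = b"
  using assms by (metis hoop_le_def divisible_ldiv mult_one)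

text \<open>Divisibility rewrites \<open>a\<close> as \<open>b \<otimes> (b \<setminus> a)\<close>,
  so \<open>a \<setminus> c\<close> unfolds to
  \<open>(b \<setminus> a) \<setminus> (b \<setminus> c)\<close>, whose numerator is
  \<open>\<one>\<close>.\<close>

lemma hoop_le_trans:
  assumes "a \<preceq> b" "b \<preceq> c" and abc: "a \<in> carrier A" "b \<in> carrier A" "c \<in> carrier A"
  shows "a \<preceq> c"
proof -
  have "a = b \<otimes> (b \<setminus> a)"
    using assms by (metis hoop_le_def divisible_ldiv mult_one)
  then have "a \<setminus> c = (b \<setminus> a) \<setminus> (b \<setminus> c)"
    using abc by (metis mult_ldiv ldiv_closed)
  then show ?thesis
    using assms by (simp add: hoop_le_def one_top ldiv_closed)
qed

lemma le_one: "a \<in> carrier A \<Longrightarrow> a \<preceq> \<one>"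
  by (simp add: hoop_le_def one_top)

lemma one_le_iff: "a \<in> carrier A \<Longrightarrow> \<one> \<preceq> a \<longleftrightarrow> a = \<one>"
  by (simp add: hoop_le_def ldiv_one)

lemma le_ldiv_iff:
  assumes "x \<in> carrier A" "y \<in> carrier A" "z \<in> carrier A"
  shows "y \<preceq> x \<setminus> z \<longleftrightarrow> x \<otimes> y \<preceq> z"
  using assms by (simp add: hoop_le_def mult_ldiv)

lemma le_rdiv_iff:
  assumes "x \<in> carrier A" "y \<in> carrier A" "z \<in> carrier A"
  shows "x \<preceq> z \<oslash> y \<longleftrightarrow> x \<otimes> y \<preceq> z"
  using assms by (simp add: hoop_le_iff_rdiv rdiv_mult hoop_closed)

lemma mult_ldiv_le: "\<lbrakk>a \<in> carrier A; b \<in> carrier A\<rbrakk> \<Longrightarrow> a \<otimes> (a \<setminus> b) \<preceq> b"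
  by (metis le_ldiv_iff hoop_le_refl ldiv_closed)

lemma rdiv_mult_le: "\<lbrakk>a \<in> carrier A; b \<in> carrier A\<rbrakk> \<Longrightarrow> (b \<oslash> a) \<otimes> a \<preceq> b"
  by (metis le_rdiv_iff hoop_le_refl rdiv_closed)

lemma mult_mono_right:
  assumes "b \<preceq> c" "a \<in> carrier A" "b \<in> carrier A" "c \<in> carrier A"
  shows "a \<otimes> b \<preceq> a \<otimes> c"
proof -
  have "c \<preceq> a \<setminus> (a \<otimes> c)"
    using assms by (simp add: le_ldiv_iff hoop_le_refl hoop_closed)
  then have "b \<preceq> a \<setminus> (a \<otimes> c)"
    using assms by (meson hoop_le_trans hoop_closed)
  then show ?thesis
    using assms by (simp add: le_ldiv_iff hoop_closed)
qed

lemma mult_mono_left: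
  assumes "b \<preceq> c" "a \<in> carrier A" "b \<in> carrier A" "c \<in> carrier A"
  shows "b \<otimes> a \<preceq> c \<otimes> a"
proof -
  have "c \<preceq> (c \<otimes> a) \<oslash> a"
    using assms by (simp add: le_rdiv_iff hoop_le_refl hoop_closed)
  then have "b \<preceq> (c \<otimes> a) \<oslash> a"
    using assms by (meson hoop_le_trans hoop_closed)
  then show ?thesis
    using assms by (simp add: le_rdiv_iff hoop_closed)
qed

lemma mult_le_left: "\<lbrakk>a \<in> carrier A; b \<in> carrier A\<rbrakk> \<Longrightarrow> a \<otimes> b \<preceq> a"
  by (metis mult_mono_right le_one mult_one one_closed)

text \<open>Associativity is not an axiom. Dividing any \<open>z\<close> by either product gives
  \<open>c \<setminus> (b \<setminus> (a \<setminus> z))\<close>, so the two products have the same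
  upper bounds.\<close>

lemma mult_assoc:
  assumes a: "a \<in> carrier A" and b: "b \<in> carrier A" and c: "c \<in> carrier A"
  shows "(a \<otimes> b) \<otimes> c = a \<otimes> (b \<otimes> c)"
proof -
  have "(a \<otimes> b) \<otimes> c \<preceq> z \<longleftrightarrow> a \<otimes> (b \<otimes> c) \<preceq> z" if "z \<in> carrier A" for z
    using that a b c by (simp add: hoop_le_def mult_ldiv hoop_closed)
  then show ?thesis
    using a b c by (meson hoop_le_antisym hoop_le_refl mult_closed)
qed

text \<open>This inequality and its mirror image below make the relation induced by a filter
  transitive and compatible with both divisions.\<close>

lemma ldiv_mult_ldiv_le:
  assumes "a \<in> carrier A" "b \<in> carrier A" "c \<in> carrier A"
  shows "(a \<setminus> b) \<otimes> (b \<setminus> c) \<preceq> a \<setminus> c"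
proof -
  have "a \<otimes> ((a \<setminus> b) \<otimes> (b \<setminus> c)) \<preceq> b \<otimes> (b \<setminus> c)"
    using assms by (simp add: mult_assoc[symmetric] mult_mono_left mult_ldiv_le hoop_closed)
  then have "a \<otimes> ((a \<setminus> b) \<otimes> (b \<setminus> c)) \<preceq> c"
    by (rule hoop_le_trans) (use assms in \<open>simp_all add: mult_ldiv_le hoop_closed\<close>)
  then show ?thesis
    using assms by (simp add: le_ldiv_iff hoop_closed)
qed

lemma rdiv_mult_rdiv_le:
  assumes "a \<in> carrier A" "b \<in> carrier A" "c \<in> carrier A"
  shows "(c \<oslash> b) \<otimes> (b \<oslash> a) \<preceq> c \<oslash> a"
proof -
  have "((c \<oslash> b) \<otimes> (b \<oslash> a)) \<otimes> a \<preceq> (c \<oslash> b) \<otimes> b"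
    using assms by (simp add: mult_assoc mult_mono_right rdiv_mult_le hoop_closed)
  then have "((c \<oslash> b) \<otimes> (b \<oslash> a)) \<otimes> a \<preceq> c"
    by (rule hoop_le_trans) (use assms in \<open>simp_all add: rdiv_mult_le hoop_closed\<close>)
  then show ?thesis
    using assms by (simp add: le_rdiv_iff hoop_closed)
qed

section \<open>Meets and joins of elements\<close>

lemma hoop_meet_closed: "\<lbrakk>a \<in> carrier A; b \<in> carrier A\<rbrakk> \<Longrightarrow> hoop_meet A a b \<in> carrier A"
  by (simp add: hoop_meet_def hoop_closed)

lemma hoop_join_closed: "\<lbrakk>a \<in> carrier A; b \<in> carrier A\<rbrakk> \<Longrightarrow> hoop_join A a b \<in> carrier A"
  by (simp add: hoop_join_def hoop_meet_closed hoop_closed)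

lemma hoop_meet_lower:
  assumes "a \<in> carrier A" "b \<in> carrier A"
  shows "hoop_meet A a b \<preceq> a" "hoop_meet A a b \<preceq> b"
  using assms by (simp_all add: hoop_meet_def mult_le_left mult_ldiv_le hoop_closed)

text \<open>By divisibility an element \<open>c\<close> below \<open>a\<close> equals
  \<open>a \<otimes> (a \<setminus> c)\<close>, which reduces the claim to monotonicity of the
  second factor.\<close>

lemma hoop_meet_greatest:
  assumes c: "c \<preceq> a" "c \<preceq> b"
    and abc: "a \<in> carrier A" "b \<in> carrier A" "c \<in> carrier A"
  shows "c \<preceq> hoop_meet A a b"
proof -
  have c_eq: "c = a \<otimes> (a \<setminus> c)"
    using c abc by (metis hoop_le_def divisible_ldiv mult_one)
  have "a \<setminus> c \<preceq> a \<setminus> b"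
    using c abc c_eq by (metis le_ldiv_iff ldiv_closed)
  then have "a \<otimes> (a \<setminus> c) \<preceq> a \<otimes> (a \<setminus> b)"
    using abc by (simp add: mult_mono_right hoop_closed)
  then show ?thesis
    using c_eq by (simp add: hoop_meet_def)
qed

lemma hoop_join_upper:
  assumes a: "a \<in> carrier A" and b: "b \<in> carrier A"
  shows "a \<preceq> hoop_join A a b" "b \<preceq> hoop_join A a b"
proof -
  have "x \<preceq> y \<oslash> (x \<setminus> y)" "y \<preceq> y \<oslash> (x \<setminus> y)"
    if "x \<in> carrier A" "y \<in> carrier A" for x y
    using that by (simp_all add: le_rdiv_iff mult_ldiv_le mult_le_left hoop_closed)
  then show "a \<preceq> hoop_join A a b" "b \<preceq> hoop_join A a b"
    using a b by (simp_all add: hoop_join_def hoop_meet_greatest hoop_closed)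
qed

end

context basic_pseudo_hoop
begin

text \<open>Under the hypotheses \<open>(a \<setminus> b) \<setminus> c\<close> and
  \<open>(b \<setminus> a) \<setminus> c\<close> are both \<open>\<one>\<close>, so the basic
  inequality collapses to \<open>\<one> \<preceq> c\<close>.\<close>

lemma prelinear:
  assumes "a \<setminus> b \<preceq> c" "b \<setminus> a \<preceq> c"
    and "a \<in> carrier A" "b \<in> carrier A" "c \<in> carrier A"
  shows "c = \<one>"
  using basic_ldiv[of a b c] assms by (simp add: hoop_le_def ldiv_one hoop_closed)

text \<open>Multiplying the join on the right by \<open>a \<setminus> b\<close> lands below
  \<open>b\<close>, and by \<open>b \<setminus> a\<close> below \<open>a\<close>. Hence the join
  divided into \<open>c\<close> dominates both differences, and prelinearity makes it
  \<open>\<one>\<close>.\<close>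

lemma hoop_join_least:
  assumes c: "a \<preceq> c" "b \<preceq> c"
    and abc: "a \<in> carrier A" "b \<in> carrier A" "c \<in> carrier A"
  shows "hoop_join A a b \<preceq> c"
proof -
  let ?j = "hoop_join A a b"
  have j: "?j \<in> carrier A"
    using abc by (simp add: hoop_join_closed)
  have "?j \<preceq> b \<oslash> (a \<setminus> b)" "?j \<preceq> a \<oslash> (b \<setminus> a)"
    using abc by (simp_all add: hoop_join_def hoop_meet_lower hoop_closed)
  then have "?j \<otimes> (a \<setminus> b) \<preceq> b" "?j \<otimes> (b \<setminus> a) \<preceq> a"
    using abc j by (simp_all add: le_rdiv_iff hoop_closed)
  then have "?j \<otimes> (a \<setminus> b) \<preceq> c" "?j \<otimes> (b \<setminus> a) \<preceq> c"
    using c abc j by (meson hoop_le_trans hoop_closed)+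
  then have "a \<setminus> b \<preceq> ?j \<setminus> c" "b \<setminus> a \<preceq> ?j \<setminus> c"
    using abc j by (simp_all add: le_ldiv_iff hoop_closed)
  then have "?j \<setminus> c = \<one>"
    using abc j by (meson prelinear ldiv_closed)
  then show ?thesis
    by (simp add: hoop_le_def)
qed

end

section \<open>Homomorphisms and quotients\<close>

definition hoop_hom ::
  "('a, 'm) pseudo_hoop_scheme \<Rightarrow> ('b, 'n) pseudo_hoop_scheme \<Rightarrow> ('a \<Rightarrow> 'b) set"
  where "hoop_hom A B = {q \<in> carrier A \<rightarrow> carrier B.
    (\<forall>a\<in>carrier A. \<forall>b\<in>carrier A.
       q (a \<otimes>\<^bsub>A\<^esub> b) = q a \<otimes>\<^bsub>B\<^esub> q b \<and>
       q (a \<setminus>\<^bsub>A\<^esub> b) = q a \<setminus>\<^bsub>B\<^esub> q b \<and>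
       q (a \<oslash>\<^bsub>A\<^esub> b) = q a \<oslash>\<^bsub>B\<^esub> q b) \<and>
    q \<one>\<^bsub>A\<^esub> = \<one>\<^bsub>B\<^esub>}"

context
  fixes A :: "('a, 'm) pseudo_hoop_scheme" and B :: "('b, 'n) pseudo_hoop_scheme" and q
  assumes q: "q \<in> hoop_hom A B"
begin

lemma hoop_hom_closed: "a \<in> carrier A \<Longrightarrow> q a \<in> carrier B"
  using q by (auto simp: hoop_hom_def)

lemma hoop_hom_simps:
  "q \<one>\<^bsub>A\<^esub> = \<one>\<^bsub>B\<^esub>"
  "\<lbrakk>a \<in> carrier A; b \<in> carrier A\<rbrakk> \<Longrightarrow> q (a \<otimes>\<^bsub>A\<^esub> b) = q a \<otimes>\<^bsub>B\<^esub> q b"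
  "\<lbrakk>a \<in> carrier A; b \<in> carrier A\<rbrakk> \<Longrightarrow> q (a \<setminus>\<^bsub>A\<^esub> b) = q a \<setminus>\<^bsub>B\<^esub> q b"
  "\<lbrakk>a \<in> carrier A; b \<in> carrier A\<rbrakk> \<Longrightarrow> q (a \<oslash>\<^bsub>A\<^esub> b) = q a \<oslash>\<^bsub>B\<^esub> q b"
  using q by (auto simp: hoop_hom_def)

lemma hoop_hom_le: "\<lbrakk>a \<in> carrier A; b \<in> carrier A; a \<preceq>\<^bsub>A\<^esub> b\<rbrakk> \<Longrightarrow> q a \<preceq>\<^bsub>B\<^esub> q b"
  by (metis hoop_le_def hoop_hom_simps(1,3))

lemma hoop_hom_meet_join:
  assumes "pseudo_hoop A" "a \<in> carrier A" "b \<in> carrier A"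
  shows "q (hoop_meet A a b) = hoop_meet B (q a) (q b)"
    and "q (hoop_join A a b) = hoop_join B (q a) (q b)"
  using assms
  by (simp_all add: hoop_meet_def hoop_join_def hoop_hom_simps pseudo_hoop.mult_closed
      pseudo_hoop.ldiv_closed pseudo_hoop.rdiv_closed)

lemma hoop_hom_image:
  assumes A: "pseudo_hoop A" and surj: "q ` carrier A = carrier B"
  shows "pseudo_hoop B"
proof -
  interpret pseudo_hoop A by (fact A)
  note s = surj[symmetric]
  note h = hoop_hom_simps[symmetric]
  show ?thesis
    by unfold_locales
      (auto simp: s h hoop_closed mult_one one_mult ldiv_self rdiv_self rdiv_mult mult_ldiv,
       auto simp: divisible_rdiv divisible_rdiv_ldiv divisible_ldiv)
qed

lemma hoop_hom_image_basic:
  assumes A: "basic_pseudo_hoop A" and surj: "q ` carrier A = carrier B"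
  shows "basic_pseudo_hoop B"
proof -
  interpret basic_pseudo_hoop A by (fact A)
  interpret B: pseudo_hoop B
    using hoop_hom_image pseudo_hoop_axioms surj by blast
  show ?thesis
    by unfold_locales
      (auto simp: surj[symmetric] hoop_hom_simps[symmetric] hoop_closed
        intro!: hoop_hom_le basic_rdiv basic_ldiv)
qed

text \<open>Carries filters of a quotient back to \<open>A\<close>, where maximality can be
  applied.\<close>

lemma normal_filter_vimage:
  assumes A: "pseudo_hoop A" and B: "pseudo_hoop B" and G: "normal_filter B G"
  shows "normal_filter A {a \<in> carrier A. q a \<in> G}"
proof -
  interpret pseudo_hoop A by (fact A)
  interpret B: pseudo_hoop B by (fact B)
  have filter: "hoop_filter B G"
    using G by (simp add: normal_filter_def)
  then have le: "y \<in> G" if "x \<in> G" "x \<preceq>\<^bsub>B\<^esub> y" "y \<in> carrier B" for x y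
    using that by (auto simp: hoop_filter_def)
  obtain x where "x \<in> G" "x \<in> carrier B"
    using filter by (auto simp: hoop_filter_def)
  then have "\<one>\<^bsub>B\<^esub> \<in> G"
    using le B.le_one B.one_closed by blast
  then have "{a \<in> carrier A. q a \<in> G} \<noteq> {}"
    using hoop_hom_simps(1) one_closed by force
  moreover have "q b \<in> G" if "q a \<in> G" "a \<preceq>\<^bsub>A\<^esub> b" "a \<in> carrier A" "b \<in> carrier A" for a b
    using that by (blast intro: le hoop_hom_le hoop_hom_closed)
  moreover have "q (a \<otimes>\<^bsub>A\<^esub> b) \<in> G"
    if "q a \<in> G" "q b \<in> G" "a \<in> carrier A" "b \<in> carrier A" for a b
    using filter that by (simp add: hoop_hom_simps hoop_filter_def)
  moreover have "q (b \<oslash>\<^bsub>A\<^esub> a) \<in> G \<longleftrightarrow> q (a \<setminus>\<^bsub>A\<^esub> b) \<in> G"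
    if "a \<in> carrier A" "b \<in> carrier A" for a b
    using G that by (simp add: hoop_hom_simps hoop_hom_closed normal_filter_def)
  ultimately show ?thesis
    unfolding normal_filter_def hoop_filter_def by (auto simp: hoop_closed)
qed

end

section \<open>Quotients by normal filters\<close>

definition filter_class :: "('a, 'm) pseudo_hoop_scheme \<Rightarrow> 'a set \<Rightarrow> 'a \<Rightarrow> 'a set"
  where "filter_class A F a =
    {b \<in> carrier A. a \<setminus>\<^bsub>A\<^esub> b \<in> F \<and> b \<setminus>\<^bsub>A\<^esub> a \<in> F}"

text \<open>Operations act on chosen representatives; independence of the choice is part of
  \<open>filter_class_hom\<close>. Taking classes as elements is what gives the factor kites
  coefficients of type \<open>'a set\<close>.\<close>

definition quotient_hoop :: "('a, 'm) pseudo_hoop_scheme \<Rightarrow> 'a set \<Rightarrow> 'a set pseudo_hoop"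
  where "quotient_hoop A F =
    \<lparr>carrier = filter_class A F ` carrier A,
     monoid.mult = (\<lambda>X Y. filter_class A F ((SOME a. a \<in> X) \<otimes>\<^bsub>A\<^esub> (SOME b. b \<in> Y))),
     one = filter_class A F \<one>\<^bsub>A\<^esub>,
     ldiv = (\<lambda>X Y. filter_class A F ((SOME a. a \<in> X) \<setminus>\<^bsub>A\<^esub> (SOME b. b \<in> Y))),
     rdiv = (\<lambda>X Y. filter_class A F ((SOME a. a \<in> X) \<oslash>\<^bsub>A\<^esub> (SOME b. b \<in> Y)))\<rparr>"

context pseudo_hoop
begin

context
  fixes F
  assumes F: "normal_filter A F"
begin

lemma filter_closed: "a \<in> F \<Longrightarrow> a \<in> carrier A"
  using F by (auto simp: normal_filter_def hoop_filter_def)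

lemma filter_mult: "\<lbrakk>a \<in> F; b \<in> F\<rbrakk> \<Longrightarrow> a \<otimes> b \<in> F"
  using F by (auto simp: normal_filter_def hoop_filter_def)

lemma filter_up: "\<lbrakk>a \<in> F; a \<preceq> b; b \<in> carrier A\<rbrakk> \<Longrightarrow> b \<in> F"
  using F by (auto simp: normal_filter_def hoop_filter_def)

lemma filter_normal: "\<lbrakk>a \<in> carrier A; b \<in> carrier A\<rbrakk> \<Longrightarrow> b \<oslash> a \<in> F \<longleftrightarrow> a \<setminus> b \<in> F"
  using F by (auto simp: normal_filter_def)

lemma filter_one: "\<one> \<in> F"
  using F filter_up le_one one_closed filter_closed
  by (metis normal_filter_def hoop_filter_def ex_in_conv)

lemma filter_ldiv_trans:
  assumes "a \<setminus> b \<in> F" "b \<setminus> c \<in> F" and abc: "a \<in> carrier A" "b \<in> carrier A" "c \<in> carrier A"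
  shows "a \<setminus> c \<in> F"
  using filter_up[OF filter_mult ldiv_mult_ldiv_le] assms by (simp add: hoop_closed)

text \<open>First of six compatibility lemmas, one for each argument of each operation. In each, a
  difference of \<open>b\<close> and \<open>c\<close> already in the filter lies below a left or
  right difference of the results.\<close>

lemma filter_mult_left:
  assumes "b \<setminus> c \<in> F" and abc: "a \<in> carrier A" "b \<in> carrier A" "c \<in> carrier A"
  shows "(a \<otimes> b) \<setminus> (a \<otimes> c) \<in> F"
proof -
  have "b \<setminus> c \<preceq> (a \<otimes> b) \<setminus> (a \<otimes> c)"
    using abc by (simp add: le_ldiv_iff mult_assoc mult_mono_right mult_ldiv_le hoop_closed)
  from filter_up[OF _ this] show ?thesis
    using assms by (simp add: filter_normal hoop_closed)
qed

text \<open>The natural bound is for right division, so normality is used twice: to replace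
  \<open>b \<setminus> c\<close> by \<open>c \<oslash> b\<close>, and to return to left division at
  the end.\<close>

lemma filter_mult_right:
  assumes "b \<setminus> c \<in> F" and abc: "a \<in> carrier A" "b \<in> carrier A" "c \<in> carrier A"
  shows "(b \<otimes> a) \<setminus> (c \<otimes> a) \<in> F"
proof -
  have "c \<oslash> b \<preceq> (c \<otimes> a) \<oslash> (b \<otimes> a)"
    using abc by (simp add: le_rdiv_iff mult_assoc[symmetric] mult_mono_left rdiv_mult_le hoop_closed)
  from filter_up[OF _ this] show ?thesis
    using assms by (simp add: filter_normal hoop_closed)
qed

lemma filter_ldiv_right:
  assumes "b \<setminus> c \<in> F" and abc: "a \<in> carrier A" "b \<in> carrier A" "c \<in> carrier A"
  shows "(a \<setminus> b) \<setminus> (a \<setminus> c) \<in> F"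
proof -
  have "b \<setminus> c \<preceq> (a \<setminus> b) \<setminus> (a \<setminus> c)"
    using abc by (subst le_ldiv_iff) (simp_all add: ldiv_mult_ldiv_le hoop_closed)
  from filter_up[OF _ this] show ?thesis
    using assms by (simp add: filter_normal hoop_closed)
qed

lemma filter_ldiv_left:
  assumes "b \<setminus> c \<in> F" and abc: "a \<in> carrier A" "b \<in> carrier A" "c \<in> carrier A"
  shows "(c \<setminus> a) \<setminus> (b \<setminus> a) \<in> F"
proof -
  have "b \<setminus> c \<preceq> (b \<setminus> a) \<oslash> (c \<setminus> a)"
    using abc by (subst le_rdiv_iff) (simp_all add: ldiv_mult_ldiv_le hoop_closed)
  from filter_up[OF _ this] show ?thesis
    using assms by (simp add: filter_normal hoop_closed)
qed

lemma filter_rdiv_right: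
  assumes "b \<setminus> c \<in> F" and abc: "a \<in> carrier A" "b \<in> carrier A" "c \<in> carrier A"
  shows "(b \<oslash> a) \<setminus> (c \<oslash> a) \<in> F"
proof -
  have "c \<oslash> b \<preceq> (c \<oslash> a) \<oslash> (b \<oslash> a)"
    using abc by (subst le_rdiv_iff) (simp_all add: rdiv_mult_rdiv_le hoop_closed)
  from filter_up[OF _ this] show ?thesis
    using assms by (simp add: filter_normal hoop_closed)
qed

lemma filter_rdiv_left:
  assumes "b \<setminus> c \<in> F" and abc: "a \<in> carrier A" "b \<in> carrier A" "c \<in> carrier A"
  shows "(a \<oslash> c) \<setminus> (a \<oslash> b) \<in> F"
proof -
  have "c \<oslash> b \<preceq> (a \<oslash> c) \<setminus> (a \<oslash> b)"
    using abc by (subst le_ldiv_iff) (simp_all add: rdiv_mult_rdiv_le hoop_closed)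
  from filter_up[OF _ this] show ?thesis
    using assms by (simp add: filter_normal hoop_closed)
qed

lemma filter_class_eq_iff:
  assumes "a \<in> carrier A" "b \<in> carrier A"
  shows "filter_class A F a = filter_class A F b \<longleftrightarrow> a \<setminus> b \<in> F \<and> b \<setminus> a \<in> F"
proof
  assume "filter_class A F a = filter_class A F b"
  moreover have "a \<in> filter_class A F a"
    using assms by (simp add: filter_class_def ldiv_self filter_one)
  ultimately show "a \<setminus> b \<in> F \<and> b \<setminus> a \<in> F"
    by (simp add: filter_class_def)
next
  assume "a \<setminus> b \<in> F \<and> b \<setminus> a \<in> F"
  then show "filter_class A F a = filter_class A F b"
    using assms by (auto simp: filter_class_def intro: filter_ldiv_trans)
qed

lemma filter_class_eq_one_iff:
  assumes "a \<in> carrier A"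
  shows "filter_class A F a = filter_class A F \<one> \<longleftrightarrow> a \<in> F"
  using assms by (simp add: filter_class_eq_iff one_top ldiv_one filter_one one_closed)

lemma filter_class_hom: "filter_class A F \<in> hoop_hom A (quotient_hoop A F)"
proof -
  \<comment> \<open>The representative picked from the class of \<open>a\<close> need not be
    \<open>a\<close>, but it is congruent to \<open>a\<close>.\<close>
  have rep: "(SOME b. b \<in> filter_class A F a) \<in> carrier A \<and>
      a \<setminus> (SOME b. b \<in> filter_class A F a) \<in> F \<and> (SOME b. b \<in> filter_class A F a) \<setminus> a \<in> F"
    if "a \<in> carrier A" for a
  proof -
    have "a \<in> filter_class A F a"
      using that by (simp add: filter_class_def ldiv_self filter_one)
    then have "(SOME b. b \<in> filter_class A F a) \<in> filter_class A F a"
      by (rule someI)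
    then show ?thesis
      by (simp add: filter_class_def)
  qed
  have cong: "filter_class A F (a \<otimes> b) = filter_class A F (c \<otimes> d)"
      "filter_class A F (a \<setminus> b) = filter_class A F (c \<setminus> d)"
      "filter_class A F (a \<oslash> b) = filter_class A F (c \<oslash> d)"
    if "a \<setminus> c \<in> F" "c \<setminus> a \<in> F" "b \<setminus> d \<in> F" "d \<setminus> b \<in> F"
      "a \<in> carrier A" "b \<in> carrier A" "c \<in> carrier A" "d \<in> carrier A" for a b c d
  proof -
    \<comment> \<open>The arguments are replaced one at a time, passing through the term in
      \<open>a\<close> and \<open>d\<close>.\<close>
    have "filter_class A F (a \<otimes> b) = filter_class A F (a \<otimes> d)"
      "filter_class A F (a \<setminus> b) = filter_class A F (a \<setminus> d)"
      "filter_class A F (a \<oslash> b) = filter_class A F (a \<oslash> d)"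
      using that by (simp_all add: filter_class_eq_iff hoop_closed filter_mult_left
          filter_ldiv_right filter_rdiv_left)
    moreover have "filter_class A F (a \<otimes> d) = filter_class A F (c \<otimes> d)"
      "filter_class A F (a \<setminus> d) = filter_class A F (c \<setminus> d)"
      "filter_class A F (a \<oslash> d) = filter_class A F (c \<oslash> d)"
      using that by (simp_all add: filter_class_eq_iff hoop_closed filter_mult_right
          filter_ldiv_left filter_rdiv_right)
    ultimately show "filter_class A F (a \<otimes> b) = filter_class A F (c \<otimes> d)"
      "filter_class A F (a \<setminus> b) = filter_class A F (c \<setminus> d)"
      "filter_class A F (a \<oslash> b) = filter_class A F (c \<oslash> d)"
      by simp_all
  qed
  show ?thesis
    unfolding hoop_hom_def
    by (intro CollectI conjI ballI funcsetI;
        simp add: quotient_hoop_def; rule cong; simp add: rep)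
qed

lemma filter_class_image: "filter_class A F ` carrier A = carrier (quotient_hoop A F)"
  by (simp add: quotient_hoop_def)

lemma pseudo_hoop_quotient: "pseudo_hoop (quotient_hoop A F)"
  using hoop_hom_image filter_class_hom filter_class_image pseudo_hoop_axioms by blast

end

section \<open>Normal filters maximal without a given element\<close>

lemma normal_filter_carrier: "normal_filter A (carrier A)"
  proof -
  have "carrier A \<noteq> {}"
    using one_closed by blast
  then show ?thesis
    by (simp add: normal_filter_def hoop_filter_def hoop_closed)
qed

text \<open>Normality of \<open>{\<one>}\<close> is the agreement of the two descriptions of the
  order by left and by right division.\<close>

lemma normal_filter_one: "normal_filter A {\<one>}"
proof -
  have "b \<oslash> a = \<one> \<longleftrightarrow> a \<setminus> b = \<one>" if "a \<in> carrier A" "b \<in> carrier A" for a b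
    using hoop_le_iff_rdiv[OF that] by (simp add: hoop_le_def)
  then show ?thesis
    by (auto simp: normal_filter_def hoop_filter_def one_closed mult_one one_le_iff)
qed

text \<open>Provides the upper bounds for Zorn. Comparability of chain members is needed for
  products only, to place both factors in one member.\<close>

lemma normal_filter_Union:
  assumes C: "subset.chain {F. normal_filter A F} C" and "C \<noteq> {}"
  shows "normal_filter A (\<Union>C)"
proof -
  have nf: "normal_filter A F" if "F \<in> C" for F
    using C that by (auto simp: subset.chain_def)
  have "\<exists>F\<in>C. x \<in> F \<and> y \<in> F" if xy: "x \<in> \<Union>C" "y \<in> \<Union>C" for x y
  proof -
    obtain F G where FG: "F \<in> C" "x \<in> F" "G \<in> C" "y \<in> G"
      using xy by blast
    then have "F \<subseteq> G \<or> G \<subseteq> F"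
      using C by (simp add: subset_chain_def)
    then show ?thesis
      using FG by blast
  qed
  then have "\<forall>x\<in>\<Union>C. \<forall>y\<in>\<Union>C. x \<otimes> y \<in> \<Union>C"
    using filter_mult[OF nf] by blast
  moreover have "\<Union>C \<noteq> {}"
    using assms(2) nf filter_one by blast
  moreover have "\<Union>C \<subseteq> carrier A"
    using filter_closed[OF nf] by blast
  moreover have "\<forall>x\<in>\<Union>C. \<forall>y\<in>carrier A. x \<preceq> y \<longrightarrow> y \<in> \<Union>C"
    using filter_up[OF nf] by blast
  moreover have "\<forall>a\<in>carrier A. \<forall>b\<in>carrier A. b \<oslash> a \<in> \<Union>C \<longleftrightarrow> a \<setminus> b \<in> \<Union>C"
    using filter_normal[OF nf] by blast
  ultimately show ?thesis
    by (simp add: normal_filter_def hoop_filter_def)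
qed

text \<open>The witness \<open>c\<close> is kept next to \<open>F\<close> because its class is a
  nontrivial element common to all nontrivial normal filters of the quotient.\<close>

definition monolithic_filter :: "'a set \<Rightarrow> 'a \<Rightarrow> bool"
  where "monolithic_filter F c \<longleftrightarrow> normal_filter A F \<and> c \<in> carrier A \<and> c \<notin> F \<and>
    (\<forall>G. normal_filter A G \<and> F \<subset> G \<longrightarrow> c \<in> G)"

text \<open>Zorn applied to the normal filters avoiding \<open>c\<close>, a family that contains
  \<open>{\<one>}\<close> because \<open>c \<noteq> \<one>\<close>.\<close>

lemma monolithic_filter_exists:
  assumes c: "c \<in> carrier A" "c \<noteq> \<one>"
  obtains F where "monolithic_filter F c"
proof -
  let ?P = "{F. normal_filter A F \<and> c \<notin> F}"
  have "\<Union>C \<in> ?P" if "C \<noteq> {}" "subset.chain ?P C" for C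
    using that normal_filter_Union[of C] by (auto simp: subset.chain_def)
  moreover have "?P \<noteq> {}"
    using c normal_filter_one by blast
  ultimately obtain F where "F \<in> ?P" "\<forall>G\<in>?P. F \<subseteq> G \<longrightarrow> G = F"
    using subset_Zorn_nonempty[of ?P] by auto
  then have "monolithic_filter F c"
    using c by (auto simp: monolithic_filter_def)
  then show ?thesis
    by (rule that)
qed

text \<open>The preimage of \<open>G\<close> is a normal filter containing \<open>F\<close>,
  properly so because \<open>G\<close> has a class other than that of \<open>\<one>\<close>;
  maximality of \<open>F\<close> then puts \<open>c\<close> into it.\<close>

lemma quotient_monolith:
  assumes F: "monolithic_filter F c"
    and G: "normal_filter (quotient_hoop A F) G" "G \<noteq> {\<one>\<^bsub>quotient_hoop A F\<^esub>}"
  shows "filter_class A F c \<in> G"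
proof -
  have nf: "normal_filter A F"
    using F by (simp add: monolithic_filter_def)
  interpret Q: pseudo_hoop "quotient_hoop A F"
    using nf by (rule pseudo_hoop_quotient)
  let ?H = "{a \<in> carrier A. filter_class A F a \<in> G}"
  have one: "\<one>\<^bsub>quotient_hoop A F\<^esub> = filter_class A F \<one>"
    by (simp add: quotient_hoop_def)
  have "normal_filter A ?H"
    using nf G by (intro normal_filter_vimage[OF filter_class_hom]
        pseudo_hoop_axioms pseudo_hoop_quotient)
  moreover have "F \<subseteq> ?H"
    using Q.filter_one[OF G(1)] filter_class_eq_one_iff[OF nf] filter_closed[OF nf] one by force
  moreover obtain X where "X \<in> G" "X \<noteq> \<one>\<^bsub>quotient_hoop A F\<^esub>"
    using G Q.filter_one by blast
  then obtain a where "a \<in> carrier A" "filter_class A F a \<in> G"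
      "filter_class A F a \<noteq> filter_class A F \<one>"
    using Q.filter_closed[OF G(1)] one by (force simp: filter_class_image[OF nf, symmetric])
  then have "a \<in> ?H" "a \<notin> F"
    using filter_class_eq_one_iff[OF nf] by auto
  ultimately have "F \<subset> ?H"
    by blast
  then show ?thesis
    using F \<open>normal_filter A ?H\<close> by (auto simp: monolithic_filter_def)
qed

end

section \<open>The lattice operations of a kite\<close>

text \<open>Explicit candidate for the infimum that \<open>kite\<close> only specifies through
  \<open>THE\<close>. On barred families the order is reversed, hence the join of \<open>A\<close>
  there.\<close>

fun kite_meet ::
  "'i set \<Rightarrow> 'j set \<Rightarrow> ('a, 'm) pseudo_hoop_scheme
    \<Rightarrow> ('a, 'i, 'j) kite_elem \<Rightarrow> ('a, 'i, 'j) kite_elem \<Rightarrow> ('a, 'i, 'j) kite_elem"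
  where
    "kite_meet I J A (Inr a) (Inr b) = Inr (\<lambda>i\<in>I. hoop_meet A (a i) (b i))"
  | "kite_meet I J A (Inl f) (Inl g) = Inl (\<lambda>j\<in>J. hoop_join A (f j) (g j))"
  | "kite_meet I J A (Inl f) (Inr b) = Inl f"
  | "kite_meet I J A (Inr a) (Inl g) = Inl g"

fun kite_join ::
  "'i set \<Rightarrow> 'j set \<Rightarrow> ('a, 'm) pseudo_hoop_scheme
    \<Rightarrow> ('a, 'i, 'j) kite_elem \<Rightarrow> ('a, 'i, 'j) kite_elem \<Rightarrow> ('a, 'i, 'j) kite_elem"
  where
    "kite_join I J A (Inr a) (Inr b) = Inr (\<lambda>i\<in>I. hoop_join A (a i) (b i))"
  | "kite_join I J A (Inl f) (Inl g) = Inl (\<lambda>j\<in>J. hoop_meet A (f j) (g j))"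
  | "kite_join I J A (Inl f) (Inr b) = Inr b"
  | "kite_join I J A (Inr a) (Inl g) = Inr a"

lemma kite_carrier_simps:
  "Inl f \<in> kite_carrier I J A \<longleftrightarrow> f \<in> J \<rightarrow>\<^sub>E carrier A"
  "Inr a \<in> kite_carrier I J A \<longleftrightarrow> a \<in> I \<rightarrow>\<^sub>E carrier A"
  by (auto simp: kite_carrier_def)

lemma kite_simps:
  "carrier (kite I J l r A) = kite_carrier I J A"
  "monoid.mult (kite I J l r A) = kite_mult I J l r A"
  "one (kite I J l r A) = kite_one I A"
  "ldiv (kite I J l r A) = kite_ldiv I J l r A"
  "rdiv (kite I J l r A) = kite_rdiv I J l r A"
  "bl_zero (kite I J l r A) = kite_zero J A"
  by (simp_all add: kite_def)

context basic_pseudo_hoop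
begin

lemma PiE_hoop_le_antisym:
  assumes "f \<in> I \<rightarrow>\<^sub>E carrier A" "g \<in> I \<rightarrow>\<^sub>E carrier A"
    and "\<forall>i\<in>I. f i \<preceq> g i" "\<forall>i\<in>I. g i \<preceq> f i"
  shows "f = g"
  using assms by (intro PiE_ext) (auto intro!: hoop_le_antisym)

text \<open>Supplies the uniqueness that evaluating \<open>THE\<close> requires.\<close>

lemma kite_le_antisym:
  assumes "kite_le I J A x y" "kite_le I J A y x" "x \<in> kite_carrier I J A" "y \<in> kite_carrier I J A"
  shows "x = y"
  using assms
  by (cases x; cases y) (auto simp: kite_carrier_simps intro: PiE_hoop_le_antisym)

text \<open>For two barred families the greatest lower bound is a coordinatewise least upper bound
  in \<open>A\<close>; basicness enters here through \<open>hoop_join_least\<close>.\<close>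

lemma kite_meet_is_glb:
  assumes x: "x \<in> kite_carrier I J A" and y: "y \<in> kite_carrier I J A"
  shows "is_glb (kite_le I J A) (kite_carrier I J A) x y (kite_meet I J A x y)"
proof -
  have "kite_meet I J A x y \<in> kite_carrier I J A"
    using x y by (cases x; cases y)
      (auto simp: kite_carrier_simps intro!: hoop_meet_closed hoop_join_closed)
  moreover have "kite_le I J A (kite_meet I J A x y) x" "kite_le I J A (kite_meet I J A x y) y"
    using x y by (cases x; cases y;
        auto simp: kite_carrier_simps PiE_mem intro!: hoop_meet_lower hoop_join_upper hoop_le_refl)+
  moreover have "kite_le I J A w (kite_meet I J A x y)"
    if "w \<in> kite_carrier I J A" "kite_le I J A w x" "kite_le I J A w y" for w
    using x y that by (cases x; cases y; cases w)
      (auto simp: kite_carrier_simps PiE_mem intro!: hoop_meet_greatest hoop_join_least)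
  ultimately show ?thesis
    by (simp add: is_glb_def)
qed

lemma kite_join_is_lub:
  assumes x: "x \<in> kite_carrier I J A" and y: "y \<in> kite_carrier I J A"
  shows "is_lub (kite_le I J A) (kite_carrier I J A) x y (kite_join I J A x y)"
proof -
  have "kite_join I J A x y \<in> kite_carrier I J A"
    using x y by (cases x; cases y)
      (auto simp: kite_carrier_simps intro!: hoop_meet_closed hoop_join_closed)
  moreover have "kite_le I J A x (kite_join I J A x y)" "kite_le I J A y (kite_join I J A x y)"
    using x y by (cases x; cases y;
        auto simp: kite_carrier_simps PiE_mem intro!: hoop_meet_lower hoop_join_upper hoop_le_refl)+
  moreover have "kite_le I J A (kite_join I J A x y) w"
    if "w \<in> kite_carrier I J A" "kite_le I J A x w" "kite_le I J A y w" for w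
    using x y that by (cases x; cases y; cases w)
      (auto simp: kite_carrier_simps PiE_mem intro!: hoop_meet_greatest hoop_join_least)
  ultimately show ?thesis
    by (simp add: is_lub_def)
qed

lemma bl_meet_kite:
  assumes "x \<in> kite_carrier I J A" "y \<in> kite_carrier I J A"
  shows "bl_meet (kite I J l r A) x y = kite_meet I J A x y"
proof -
  have "(THE z. is_glb (kite_le I J A) (kite_carrier I J A) x y z) = kite_meet I J A x y"
  proof (rule the_equality)
    show "is_glb (kite_le I J A) (kite_carrier I J A) x y (kite_meet I J A x y)"
      using assms by (rule kite_meet_is_glb)
    then show "z = kite_meet I J A x y" if "is_glb (kite_le I J A) (kite_carrier I J A) x y z" for z
      using that unfolding is_glb_def by (intro kite_le_antisym[of I J]) blast+
  qed
  then show ?thesis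
    by (simp add: kite_def)
qed

lemma bl_join_kite:
  assumes "x \<in> kite_carrier I J A" "y \<in> kite_carrier I J A"
  shows "bl_join (kite I J l r A) x y = kite_join I J A x y"
proof -
  have "(THE z. is_lub (kite_le I J A) (kite_carrier I J A) x y z) = kite_join I J A x y"
  proof (rule the_equality)
    show "is_lub (kite_le I J A) (kite_carrier I J A) x y (kite_join I J A x y)"
      using assms by (rule kite_join_is_lub)
    then show "z = kite_join I J A x y" if "is_lub (kite_le I J A) (kite_carrier I J A) x y z" for z
      using that unfolding is_lub_def by (intro kite_le_antisym[of I J]) blast+
  qed
  then show ?thesis
    by (simp add: kite_def)
qed

end

section \<open>Homomorphisms of kites\<close>

text \<open>Combines the passage to a quotient of \<open>A\<close> with the projection onto part of
  the index sets, so each subdirect factor is reached by one map.\<close>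

definition kite_map ::
  "'i set \<Rightarrow> 'j set \<Rightarrow> ('a \<Rightarrow> 'b) \<Rightarrow> ('a, 'i, 'j) kite_elem \<Rightarrow> ('b, 'i, 'j) kite_elem"
  where "kite_map I J q = map_sum (\<lambda>f. \<lambda>j\<in>J. q (f j)) (\<lambda>a. \<lambda>i\<in>I. q (a i))"

lemma kite_map_closed:
  assumes "q \<in> hoop_hom A B" "I' \<subseteq> I" "J' \<subseteq> J" "x \<in> kite_carrier I J A"
  shows "kite_map I' J' q x \<in> kite_carrier I' J' B"
  using assms(2-4)
  by (cases x) (auto simp: kite_map_def kite_carrier_simps PiE_iff
      intro!: hoop_hom_closed[OF assms(1)])

lemma (in pseudo_hoop) kite_closed:
  assumes lr: "l \<in> J \<rightarrow> I" "r \<in> J \<rightarrow> I"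
    and xy: "x \<in> kite_carrier I J A" "y \<in> kite_carrier I J A"
  shows "kite_mult I J l r A x y \<in> kite_carrier I J A"
    and "kite_ldiv I J l r A x y \<in> kite_carrier I J A"
    and "kite_rdiv I J l r A x y \<in> kite_carrier I J A"
proof -
  have lr': "l j \<in> I" "r j \<in> I" if "j \<in> J" for j
    using lr that by auto
  show "kite_mult I J l r A x y \<in> kite_carrier I J A"
    using xy by (cases x; cases y)
      (auto simp: kite_carrier_simps kite_zero_def PiE_iff hoop_closed lr')
  show "kite_ldiv I J l r A x y \<in> kite_carrier I J A"
    using xy by (cases x; cases y)
      (auto simp: kite_carrier_simps kite_one_def PiE_iff hoop_closed lr' inv_into_into)
  show "kite_rdiv I J l r A x y \<in> kite_carrier I J A"
    using xy by (cases x; cases y)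
      (auto simp: kite_carrier_simps kite_one_def PiE_iff hoop_closed lr' inv_into_into)
qed

text \<open>The conditions linking \<open>J'\<close> and \<open>I'\<close> make restriction commute
  with the operations: products at \<open>j \<in> J'\<close> read only coordinates in
  \<open>I'\<close>, and an \<open>i \<in> I'\<close> has a preimage in \<open>J\<close> exactly
  when it has one in \<open>J'\<close>. By injectivity that preimage is the same.\<close>

lemma kite_map_hom:
  fixes q :: "'a \<Rightarrow> 'b"
  assumes A: "basic_pseudo_hoop A" and B: "basic_pseudo_hoop B" and q: "q \<in> hoop_hom A B"
    and sub: "I' \<subseteq> I" "J' \<subseteq> J"
    and l: "l \<in> J \<rightarrow> I" "inj_on l J" "\<forall>j\<in>J. j \<in> J' \<longleftrightarrow> l j \<in> I'"
    and r: "r \<in> J \<rightarrow> I" "inj_on r J" "\<forall>j\<in>J. j \<in> J' \<longleftrightarrow> r j \<in> I'"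
  shows "kite_map I' J' q \<in> bl_hom (kite I J l r A) (kite I' J' l r B)"
proof -
  interpret basic_pseudo_hoop A by (fact A)
  interpret B: basic_pseudo_hoop B by (fact B)
  let ?h = "kite_map I' J' q"
  have lr': "l j \<in> I'" "r j \<in> I'" "j \<in> J" if "j \<in> J'" for j
    using that sub l r by auto
  have I': "i \<in> I" if "i \<in> I'" for i
    using that sub by blast
  have mem: "l j \<in> I' \<longleftrightarrow> j \<in> J'" "r j \<in> I' \<longleftrightarrow> j \<in> J'" if "j \<in> J" for j
    using that l(3) r(3) by auto
  have inj': "inj_on l J'" "inj_on r J'"
    using sub l(2) r(2) by (auto intro: inj_on_subset)
  note S = kite_map_def kite_carrier_simps kite_zero_def kite_one_def hoop_hom_simps[OF q]
    hoop_hom_meet_join[OF q pseudo_hoop_axioms] PiE_iff lr' I' mem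
    inv_into_f_f[OF l(2)] inv_into_f_f[OF r(2)] inv_into_f_f[OF inj'(1)] inv_into_f_f[OF inj'(2)]
  have "?h (kite_mult I J l r A x y) = kite_mult I' J' l r B (?h x) (?h y) \<and>
      ?h (kite_ldiv I J l r A x y) = kite_ldiv I' J' l r B (?h x) (?h y) \<and>
      ?h (kite_rdiv I J l r A x y) = kite_rdiv I' J' l r B (?h x) (?h y) \<and>
      ?h (kite_meet I J A x y) = kite_meet I' J' B (?h x) (?h y) \<and>
      ?h (kite_join I J A x y) = kite_join I' J' B (?h x) (?h y)"
    if "x \<in> kite_carrier I J A" "y \<in> kite_carrier I J A" for x y
    using that l(1) r(1)
    by (cases x; cases y) (auto simp: S intro!: restrict_ext)
  moreover have "?h (kite_zero J A) = kite_zero J' B" "?h (kite_one I A) = kite_one I' B"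
    by (auto simp: S intro!: restrict_ext)
  ultimately show ?thesis
    using kite_map_closed[OF q sub]
    by (auto simp: bl_hom_def kite_simps bl_meet_kite bl_join_kite B.bl_meet_kite B.bl_join_kite)
qed

lemma kite_map_surj:
  assumes "q ` carrier A = carrier B" "pseudo_hoop A" "I' \<subseteq> I" "J' \<subseteq> J"
  shows "kite_carrier I' J' B \<subseteq> kite_map I' J' q ` kite_carrier I J A"
proof
  interpret pseudo_hoop A by (fact assms)
  have lift: "\<exists>f \<in> X \<rightarrow>\<^sub>E carrier A. (\<lambda>x\<in>X'. q (f x)) = g"
    if "g \<in> X' \<rightarrow>\<^sub>E carrier B" "X' \<subseteq> X" for g and X X' :: "'x set"
  proof
    \<comment> \<open>Preimages are chosen on \<open>X'\<close>; the remaining coordinates of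
      \<open>X\<close> are filled with \<open>\<one>\<close>.\<close>
    let ?f = "\<lambda>x\<in>X. if x \<in> X' then inv_into (carrier A) q (g x) else \<one>\<^bsub>A\<^esub>"
    have inv: "inv_into (carrier A) q (g x) \<in> carrier A" "q (inv_into (carrier A) q (g x)) = g x"
      if "x \<in> X'" for x
      using \<open>g \<in> X' \<rightarrow>\<^sub>E carrier B\<close> that assms(1)
      by (metis PiE_mem inv_into_into f_inv_into_f)+
    then show "?f \<in> X \<rightarrow>\<^sub>E carrier A"
      using one_closed by auto
    show "(\<lambda>x\<in>X'. q (?f x)) = g"
    proof
      fix x
      show "(\<lambda>x\<in>X'. q (?f x)) x = g x"
        using that inv by (cases "x \<in> X'") (auto dest: PiE_arb)
    qed
  qed
  fix y assume y: "y \<in> kite_carrier I' J' B"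
  show "y \<in> kite_map I' J' q ` kite_carrier I J A"
  proof (cases y)
    case (Inl g)
    then obtain f where "f \<in> J \<rightarrow>\<^sub>E carrier A" "(\<lambda>x\<in>J'. q (f x)) = g"
      using y lift assms(4) by (metis kite_carrier_simps(1))
    then show ?thesis
      using Inl by (intro image_eqI[of _ _ "Inl f"]) (simp_all add: kite_map_def kite_carrier_simps)
  next
    case (Inr g)
    then obtain f where "f \<in> I \<rightarrow>\<^sub>E carrier A" "(\<lambda>x\<in>I'. q (f x)) = g"
      using y lift assms(3) by (metis kite_carrier_simps(2))
    then show ?thesis
      using Inr by (intro image_eqI[of _ _ "Inr f"]) (simp_all add: kite_map_def kite_carrier_simps)
  qed
qed

section \<open>Subdirectly irreducible kites\<close>

text \<open>Stated for a bare record, so that it applies to kites without pseudo hoop axioms.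
  Nothing then places \<open>\<one>\<close> in every filter, hence the assumption that the
  intersection is nonempty.\<close>

lemma normal_filter_Inter:
  assumes nf: "\<And>G. G \<in> N \<Longrightarrow> normal_filter B G" and "N \<noteq> {}" "\<Inter>N \<noteq> {}"
  shows "normal_filter B (\<Inter>N)"
proof -
  obtain G where "G \<in> N"
    using \<open>N \<noteq> {}\<close> by blast
  then have sub: "\<Inter>N \<subseteq> carrier B"
    using nf[of G] by (auto simp: normal_filter_def hoop_filter_def)
  have filter: "hoop_filter B G" if "G \<in> N" for G
    using nf[OF that] by (simp add: normal_filter_def)
  have mult: "\<forall>x\<in>\<Inter>N. \<forall>y\<in>\<Inter>N. x \<otimes>\<^bsub>B\<^esub> y \<in> \<Inter>N"
  proof (intro ballI InterI)
    fix x y G assume "x \<in> \<Inter>N" "y \<in> \<Inter>N" "G \<in> N"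
    then show "x \<otimes>\<^bsub>B\<^esub> y \<in> G"
      using filter[of G] by (simp add: hoop_filter_def)
  qed
  have up: "\<forall>x\<in>\<Inter>N. \<forall>y\<in>carrier B. x \<preceq>\<^bsub>B\<^esub> y \<longrightarrow> y \<in> \<Inter>N"
  proof (intro ballI impI InterI)
    fix x y G assume "x \<in> \<Inter>N" "y \<in> carrier B" "x \<preceq>\<^bsub>B\<^esub> y" "G \<in> N"
    then show "y \<in> G"
      using filter[of G] unfolding hoop_filter_def by blast
  qed
  have "\<forall>a\<in>carrier B. \<forall>b\<in>carrier B. b \<oslash>\<^bsub>B\<^esub> a \<in> \<Inter>N \<longleftrightarrow> a \<setminus>\<^bsub>B\<^esub> b \<in> \<Inter>N"
    using nf by (simp add: normal_filter_def)
  then show ?thesis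
    unfolding normal_filter_def hoop_filter_def
    using sub mult up \<open>\<Inter>N \<noteq> {}\<close> by (intro conjI)
qed

text \<open>The least filter is the intersection of all candidates: the carrier keeps that family
  nonempty, and \<open>c\<close> keeps the intersection different from
  \<open>{\<one>}\<close>.\<close>

lemma subdirectly_irreducibleI:
  assumes carrier: "normal_filter B (carrier B)" and c: "c \<in> carrier B" "c \<noteq> \<one>\<^bsub>B\<^esub>"
    and least: "\<And>G. \<lbrakk>normal_filter B G; G \<noteq> {\<one>\<^bsub>B\<^esub>}\<rbrakk> \<Longrightarrow> c \<in> G"
  shows "subdirectly_irreducible B"
proof -
  let ?N = "{G. normal_filter B G \<and> G \<noteq> {\<one>\<^bsub>B\<^esub>}}"
  have "carrier B \<in> ?N" "c \<in> \<Inter>?N"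
    using carrier c least by auto
  moreover from this have "normal_filter B (\<Inter>?N)"
    by (intro normal_filter_Inter) auto
  ultimately show ?thesis
    unfolding subdirectly_irreducible_def using c by (intro disjI2 exI[of _ "\<Inter>?N"]) auto
qed

lemma (in pseudo_hoop) normal_filter_kite_carrier:
  assumes "l \<in> J \<rightarrow> I" "r \<in> J \<rightarrow> I"
  shows "normal_filter (kite I J l r A) (carrier (kite I J l r A))"
proof -
  have "kite_one I A \<in> kite_carrier I J A"
    by (auto simp: kite_one_def kite_carrier_simps one_closed)
  then have "kite_carrier I J A \<noteq> {}"
    by blast
  then show ?thesis
    using assms by (simp add: normal_filter_def hoop_filter_def kite_simps kite_closed)
qed

text \<open>Without indices only the empty barred and the empty unbarred family exist, so a filter
  other than \<open>{\<one>}\<close> must contain the bottom.\<close>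

lemma (in pseudo_hoop) subdirectly_irreducible_kite_empty:
  "subdirectly_irreducible (kite {} {} l r A)"
proof (rule subdirectly_irreducibleI)
  let ?K = "kite {} {} l r A"
  show "normal_filter ?K (carrier ?K)"
    by (simp add: normal_filter_kite_carrier)
  have carrier: "carrier ?K = {kite_zero {} A, \<one>\<^bsub>?K\<^esub>}"
    by (auto simp: kite_simps kite_carrier_def kite_zero_def kite_one_def)
  then show "kite_zero {} A \<in> carrier ?K" "kite_zero {} A \<noteq> \<one>\<^bsub>?K\<^esub>"
    by (simp_all add: kite_simps kite_zero_def kite_one_def)
  show "kite_zero {} A \<in> G" if "normal_filter ?K G" "G \<noteq> {\<one>\<^bsub>?K\<^esub>}" for G
    using that carrier unfolding normal_filter_def hoop_filter_def by auto
qed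

section \<open>Normal filters of a kite seen at single coordinates\<close>

definition kite_point :: "'i set \<Rightarrow> ('a, 'm) pseudo_hoop_scheme \<Rightarrow> 'i \<Rightarrow> 'a \<Rightarrow> ('a, 'i, 'j) kite_elem"
  where "kite_point I A i b = Inr (\<lambda>k\<in>I. if k = i then b else \<one>\<^bsub>A\<^esub>)"

context pseudo_hoop
begin

lemma kite_point_simps:
  "kite_mult I J l r A (kite_point I A i a) (kite_point I A i b) = kite_point I A i (a \<otimes> b)"
  "kite_ldiv I J l r A (kite_point I A i a) (kite_point I A i b) = kite_point I A i (a \<setminus> b)"
  "kite_rdiv I J l r A (kite_point I A i a) (kite_point I A i b) = kite_point I A i (a \<oslash> b)"
  "kite_point I A i \<one> = kite_one I A"
  by (auto simp: kite_point_def kite_one_def one_closed mult_one ldiv_self rdiv_self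
      intro!: restrict_ext)

text \<open>The map \<open>kite_point I A i\<close> respects products and divisions, so this is a
  preimage of \<open>G\<close>. It is checked directly because \<open>normal_filter_vimage\<close>
  asks for a pseudo hoop as target.\<close>

lemma normal_filter_kite_point:
  assumes G: "normal_filter (kite I J l r A :: ('a, 'i, 'j) kite_elem pseudo_bl) G"
  shows "normal_filter A {b \<in> carrier A. kite_point I A i b \<in> G}"
proof -
  let ?K = "kite I J l r A :: ('a, 'i, 'j) kite_elem pseudo_bl"
  let ?d = "\<lambda>b. kite_point I A i b :: ('a, 'i, 'j) kite_elem"
  have d: "?d b \<in> carrier ?K" if "b \<in> carrier A" for b
    using that by (auto simp: kite_simps kite_carrier_simps kite_point_def one_closed)
  have le: "y \<in> G" if "x \<in> G" "x \<preceq>\<^bsub>?K\<^esub> y" "y \<in> carrier ?K" for x y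
    using G that by (auto simp: normal_filter_def hoop_filter_def)
  have mult: "x \<otimes>\<^bsub>?K\<^esub> y \<in> G" if "x \<in> G" "y \<in> G" for x y
    using G that by (auto simp: normal_filter_def hoop_filter_def)
  have normal: "y \<oslash>\<^bsub>?K\<^esub> x \<in> G \<longleftrightarrow> x \<setminus>\<^bsub>?K\<^esub> y \<in> G" if "x \<in> carrier ?K" "y \<in> carrier ?K" for x y
    using G that by (auto simp: normal_filter_def)
  obtain x where x: "x \<in> G" "x \<in> carrier ?K"
    using G by (auto simp: normal_filter_def hoop_filter_def)
  \<comment> \<open>Some member of \<open>G\<close> lies below the top, which puts the top into
    \<open>G\<close> and makes the preimage nonempty.\<close>
  have "x \<preceq>\<^bsub>?K\<^esub> ?d \<one>"
    using x by (cases x) (auto simp: hoop_le_def kite_simps kite_carrier_simps kite_point_def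
        kite_one_def one_top PiE_iff intro!: restrict_ext)
  then have "?d \<one> \<in> G"
    using x d le one_closed by blast
  then have "{b \<in> carrier A. ?d b \<in> G} \<noteq> {}"
    using one_closed by blast
  moreover have "?d (a \<otimes> b) \<in> G" if "?d a \<in> G" "?d b \<in> G" for a b
    using mult[OF that] by (simp add: kite_simps kite_point_simps)
  moreover have "?d b \<in> G" if "?d a \<in> G" "a \<preceq> b" "b \<in> carrier A" for a b
    using le[of "?d a" "?d b"] that d by (simp add: hoop_le_def kite_simps kite_point_simps)
  moreover have "?d (b \<oslash> a) \<in> G \<longleftrightarrow> ?d (a \<setminus> b) \<in> G" if "a \<in> carrier A" "b \<in> carrier A" for a b
    using normal[of "?d a" "?d b"] that d by (simp add: kite_simps kite_point_simps)
  ultimately show ?thesis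
    unfolding normal_filter_def hoop_filter_def by (auto simp: hoop_closed)
qed

text \<open>
  For the barred families \<open>f\<close> (with \<open>c\<close> at \<open>j\<close>) and \<open>g = 1\<close>, the quotients \<open>g / f\<close> and \<open>f \<setminus> g\<close>
  carry the same entry \<open>c\<close>, once at \<open>l j\<close> and once at \<open>r j\<close>.
\<close>

lemma kite_point_transfer:
  assumes G: "normal_filter (kite I J l r A :: ('a, 'i, 'j) kite_elem pseudo_bl) G"
    and lr: "l \<in> J \<rightarrow> I" "inj_on l J" "r \<in> J \<rightarrow> I" "inj_on r J"
    and j: "j \<in> J" and c: "c \<in> carrier A"
  shows "kite_point I A (l j) c \<in> G \<longleftrightarrow> kite_point I A (r j) c \<in> G"
proof -
  let ?K = "kite I J l r A :: ('a, 'i, 'j) kite_elem pseudo_bl"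
  let ?f = "Inl (\<lambda>k\<in>J. if k = j then c else \<one>) :: ('a, 'i, 'j) kite_elem"
  let ?g = "Inl (\<lambda>k\<in>J. \<one>) :: ('a, 'i, 'j) kite_elem"
  have "?f \<in> carrier ?K" "?g \<in> carrier ?K"
    using c by (auto simp: kite_simps kite_carrier_simps one_closed)
  then have "?g \<oslash>\<^bsub>?K\<^esub> ?f \<in> G \<longleftrightarrow> ?f \<setminus>\<^bsub>?K\<^esub> ?g \<in> G"
    using G by (auto simp: normal_filter_def)
  moreover have "?g \<oslash>\<^bsub>?K\<^esub> ?f = kite_point I A (l j) c"
    using c j lr by (auto simp: kite_simps kite_point_def ldiv_one one_closed inv_into_f_f
        dest: inj_onD intro!: restrict_ext)
  moreover have "?f \<setminus>\<^bsub>?K\<^esub> ?g = kite_point I A (r j) c"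
    using c j lr by (auto simp: kite_simps kite_point_def rdiv_one one_closed inv_into_f_f
        dest: inj_onD intro!: restrict_ext)
  ultimately show ?thesis
    by simp
qed

text \<open>\<open>conn\<close> expresses connectedness of the graph on \<open>I\<close> with an
  edge between \<open>l j\<close> and \<open>r j\<close> for each \<open>j\<close>. The common
  element of the nontrivial normal filters is \<open>c\<close> at one arbitrary coordinate
  \<open>i\<close>, because membership spreads along the edges.\<close>

lemma subdirectly_irreducible_kite:
  fixes I :: "'i set" and J :: "'j set"
  assumes lr: "l \<in> J \<rightarrow> I" "inj_on l J" "r \<in> J \<rightarrow> I" "inj_on r J"
    and c: "c \<in> carrier A" "c \<noteq> \<one>"
    and least: "\<And>G. \<lbrakk>normal_filter A G; G \<noteq> {\<one>}\<rbrakk> \<Longrightarrow> c \<in> G"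
    and "I \<noteq> {}"
    and conn: "\<And>D. \<lbrakk>D \<subseteq> I; D \<noteq> {}; \<forall>j\<in>J. l j \<in> D \<longleftrightarrow> r j \<in> D\<rbrakk> \<Longrightarrow> D = I"
  shows "subdirectly_irreducible (kite I J l r A)"
proof -
  let ?K = "kite I J l r A"
  obtain i where i: "i \<in> I"
    using \<open>I \<noteq> {}\<close> by blast
  have d: "kite_point I A k b \<in> carrier ?K" if "b \<in> carrier A" for k b
    using that by (auto simp: kite_simps kite_carrier_simps kite_point_def one_closed)
  show ?thesis
  proof (rule subdirectly_irreducibleI)
    show "normal_filter ?K (carrier ?K)"
      using lr by (simp add: normal_filter_kite_carrier)
    show "kite_point I A i c \<in> carrier ?K"
      using c by (simp add: d)
    show "kite_point I A i c \<noteq> \<one>\<^bsub>?K\<^esub>"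
    proof
      assume "kite_point I A i c = \<one>\<^bsub>?K\<^esub>"
      then have "(\<lambda>k\<in>I. if k = i then c else \<one>) i = (\<lambda>k\<in>I. \<one>) i"
        by (simp only: kite_simps kite_point_def kite_one_def sum.inject)
      then show False
        using i c by simp
    qed
    fix G assume G: "normal_filter ?K G" "G \<noteq> {\<one>\<^bsub>?K\<^esub>}"
    have le: "y \<in> G" if "x \<in> G" "x \<preceq>\<^bsub>?K\<^esub> y" "y \<in> carrier ?K" for x y
      using G that by (auto simp: normal_filter_def hoop_filter_def)
    obtain x where x: "x \<in> G" "x \<noteq> \<one>\<^bsub>?K\<^esub>" "x \<in> carrier ?K"
      using G unfolding normal_filter_def hoop_filter_def by blast
    show "kite_point I A i c \<in> G"
    proof (cases x)
      case (Inl f)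
      \<comment> \<open>A barred element lies below every unbarred one, so a filter containing it
        contains all points.\<close>
      then have "x \<preceq>\<^bsub>?K\<^esub> kite_point I A i c"
        by (simp add: hoop_le_def kite_simps kite_point_def)
      then show ?thesis
        using le x d c by blast
    next
      case (Inr a)
      have a: "a \<in> I \<rightarrow>\<^sub>E carrier A"
        using x Inr by (simp add: kite_simps kite_carrier_simps)
      moreover have "a \<noteq> (\<lambda>k\<in>I. \<one>)"
        using x Inr by (auto simp: kite_simps kite_one_def)
      ultimately obtain k where k: "k \<in> I" "a k \<noteq> \<one>"
        by (metis PiE_restrict restrict_ext)
      \<comment> \<open>Raising all coordinates except \<open>k\<close> to \<open>\<one>\<close>
        stays in \<open>G\<close>, which yields a nontrivial element of the filter seen at
        \<open>k\<close>.\<close>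
      have "x \<preceq>\<^bsub>?K\<^esub> kite_point I A k (a k)"
        using a Inr by (auto simp: hoop_le_def kite_simps kite_point_def kite_one_def
            one_top ldiv_self PiE_iff intro!: restrict_ext)
      then have "kite_point I A k (a k) \<in> G"
        using le x d a k by (meson PiE_mem)
      then have "{b \<in> carrier A. kite_point I A k b \<in> G} \<noteq> {\<one>}"
        using a k by (metis (mono_tags, lifting) PiE_mem mem_Collect_eq singletonD)
      then have "c \<in> {b \<in> carrier A. kite_point I A k b \<in> G}"
        by (intro least normal_filter_kite_point[OF G(1)])
      then have "k \<in> {k \<in> I. kite_point I A k c \<in> G}"
        using k by simp
      \<comment> \<open>The coordinates at which the point with value \<open>c\<close> lies in
        \<open>G\<close> form an invariant set, to which connectedness applies.\<close>
      moreover have "\<forall>j\<in>J. l j \<in> {k \<in> I. kite_point I A k c \<in> G} \<longleftrightarrow>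
          r j \<in> {k \<in> I. kite_point I A k c \<in> G}"
        using kite_point_transfer[OF G(1) lr _ c(1)] lr by auto
      ultimately have "{k \<in> I. kite_point I A k c \<in> G} = I"
        by (intro conn) auto
      then show ?thesis
        using i by blast
    qed
  qed
qed

end

section \<open>Connected components of the index set\<close>

text \<open>Reachability written as membership in every invariant set containing \<open>i\<close>.
  The sets \<open>D\<close> are not confined to \<open>I\<close>, so complements may be used as
  \<open>D\<close>.\<close>

definition kite_component :: "'i set \<Rightarrow> 'j set \<Rightarrow> ('j \<Rightarrow> 'i) \<Rightarrow> ('j \<Rightarrow> 'i) \<Rightarrow> 'i \<Rightarrow> 'i set"
  where "kite_component I J l r i =
    {k \<in> I. \<forall>D. i \<in> D \<and> (\<forall>j\<in>J. l j \<in> D \<longleftrightarrow> r j \<in> D) \<longrightarrow> k \<in> D}"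

lemma kite_component_subset: "kite_component I J l r i \<subseteq> I"
  by (auto simp: kite_component_def)

lemma kite_component_self: "i \<in> I \<Longrightarrow> i \<in> kite_component I J l r i"
  by (auto simp: kite_component_def)

lemma kite_component_closed:
  assumes "l \<in> J \<rightarrow> I" "r \<in> J \<rightarrow> I" "j \<in> J"
  shows "l j \<in> kite_component I J l r i \<longleftrightarrow> r j \<in> kite_component I J l r i"
  using assms by (auto simp: kite_component_def)

text \<open>If \<open>i\<close> were outside \<open>D\<close>, the complement of \<open>D\<close>
  would be an invariant set containing \<open>i\<close> and hence the whole component, contradicting
  that \<open>D\<close> is a nonempty part of it. So \<open>i \<in> D\<close>, and the component
  lies in \<open>D\<close>.\<close>

lemma kite_component_minimal:
  assumes D: "D \<subseteq> kite_component I J l r i" "D \<noteq> {}" "\<forall>j\<in>J. l j \<in> D \<longleftrightarrow> r j \<in> D"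
  shows "D = kite_component I J l r i"
proof -
  obtain k where k: "k \<in> D" "k \<in> kite_component I J l r i"
    using D by blast
  have "i \<in> D"
  proof (rule ccontr)
    assume "i \<notin> D"
    then have "k \<in> - D"
      using k D(3) unfolding kite_component_def by blast
    then show False
      using k by blast
  qed
  then show ?thesis
    using D unfolding kite_component_def by blast
qed

section \<open>The subdirect decomposition\<close>

text \<open>Reduces the decomposition to a family of surjective homomorphisms that together separate
  points.\<close>

lemma subdirect_productI:
  assumes hom: "\<And>s. s \<in> S \<Longrightarrow> h s \<in> bl_hom B (Bs s)"
    and surj: "\<And>s. s \<in> S \<Longrightarrow> carrier (Bs s) \<subseteq> h s ` carrier B"
    and sep: "\<And>x y. \<lbrakk>x \<in> carrier B; y \<in> carrier B; x \<noteq> y\<rbrakk> \<Longrightarrow> \<exists>s\<in>S. h s x \<noteq> h s y"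
  shows "subdirect_product B S Bs"
  unfolding subdirect_product_def
proof (intro bexI conjI ballI)
  let ?h = "\<lambda>x. \<lambda>s\<in>S. h s x"
  show "?h \<in> bl_hom B (bl_product S Bs)"
    using hom by (auto simp: bl_hom_def bl_product_def Pi_iff intro!: restrict_ext)
  show "inj_on ?h (carrier B)"
    using sep by (intro inj_onI) (metis restrict_apply')
  show "(\<lambda>x. ?h x s) ` carrier B = carrier (Bs s)" if "s \<in> S" for s
    using hom[OF that] surj[OF that] that by (auto simp: bl_hom_def)
qed

theorem theorem4p11:
  fixes A :: "'a pseudo_hoop" and I :: "'i set" and J :: "'j set" and l r :: "'j \<Rightarrow> 'i"
  assumes "basic_pseudo_hoop A"
    and "J \<lesssim> I"
    and "l \<in> J \<rightarrow> I" and "inj_on l J"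
    and "r \<in> J \<rightarrow> I" and "inj_on r J"
  shows "\<exists>(S :: ('a set \<times> 'i set) set)
            (K :: 'a set \<times> 'i set \<Rightarrow> ('a set, 'i, 'j) kite_elem pseudo_bl).
           (\<forall>s\<in>S. is_kite (K s) \<and> subdirectly_irreducible (K s)) \<and>
           subdirect_product (kite I J l r A) S K"
proof -
  interpret basic_pseudo_hoop A by (fact assms(1))
  define comp where "comp = kite_component I J l r"
  \<comment> \<open>The factor at \<open>(carrier A, {})\<close> is the two-element kite: it separates barred from unbarred
    elements even if \<open>I\<close> is empty or \<open>A\<close> is trivial.\<close>
  define S where "S = {(F, comp i) |F i. i \<in> I \<and> (\<exists>c. monolithic_filter F c)} \<union> {(carrier A, {})}"
  \<comment> \<open>Testing \<open>l j\<close> suffices: for a pair in \<open>S\<close> the set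
    \<open>C\<close> is invariant, so \<open>r j\<close> gives the same answer.\<close>
  define J' where "J' C = {j \<in> J. l j \<in> C}" for C
  define K :: "'a set \<times> 'i set \<Rightarrow> ('a set, 'i, 'j) kite_elem pseudo_bl"
    where "K s = kite (snd s) (J' (snd s)) l r (quotient_hoop A (fst s))" for s
  define h :: "'a set \<times> 'i set \<Rightarrow> ('a, 'i, 'j) kite_elem \<Rightarrow> ('a set, 'i, 'j) kite_elem"
    where "h s = kite_map (snd s) (J' (snd s)) (filter_class A (fst s))" for s
  have S: "normal_filter A F" "C \<subseteq> I" "\<forall>j\<in>J. l j \<in> C \<longleftrightarrow> r j \<in> C" if "(F, C) \<in> S" for F C
    using that assms(3,5) normal_filter_carrier kite_component_subset[of I J l r]
      kite_component_closed[of l J I r]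
    unfolding S_def comp_def monolithic_filter_def by blast+
  have basic: "basic_pseudo_hoop (quotient_hoop A F)" if "(F, C) \<in> S" for F C
    using S(1)[OF that] basic_pseudo_hoop_axioms
    by (metis hoop_hom_image_basic filter_class_hom filter_class_image)
  have J': "l \<in> J' C \<rightarrow> C" "inj_on l (J' C)" "r \<in> J' C \<rightarrow> C" "inj_on r (J' C)"
    if "(F, C) \<in> S" for F C
    using S[OF that] assms(4,6) by (auto simp: J'_def inj_on_def)
  have "is_kite (K s)" if "s \<in> S" for s
    using that basic J' unfolding is_kite_def K_def by (metis prod.collapse)
  moreover have "subdirectly_irreducible (K s)" if s: "s \<in> S" for s
  proof -
    obtain F C where FC: "s = (F, C)" "(F, C) \<in> S"
      using s by (cases s) auto
    interpret Q: basic_pseudo_hoop "quotient_hoop A F"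
      using FC basic by blast
    from FC consider "C = {}" | i c where "i \<in> I" "C = comp i" "monolithic_filter F c"
      unfolding S_def by blast
    then show ?thesis
    proof cases
      case 1
      then show ?thesis
        using Q.subdirectly_irreducible_kite_empty FC by (simp add: K_def J'_def)
    next
      case 2
      have c: "c \<in> carrier A" "c \<notin> F"
        using 2 by (simp_all add: monolithic_filter_def)
      show ?thesis
        unfolding K_def FC fst_conv snd_conv
      proof (rule Q.subdirectly_irreducible_kite)
        show "filter_class A F c \<in> carrier (quotient_hoop A F)"
          using c by (simp add: quotient_hoop_def)
        show "filter_class A F c \<noteq> \<one>\<^bsub>quotient_hoop A F\<^esub>"
          using c filter_class_eq_one_iff[OF S(1)[OF FC(2)]] by (simp add: quotient_hoop_def)
        show "filter_class A F c \<in> G"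
          if "normal_filter (quotient_hoop A F) G" "G \<noteq> {\<one>\<^bsub>quotient_hoop A F\<^esub>}" for G
          using quotient_monolith 2 that by blast
        show "C \<noteq> {}"
          using 2 kite_component_self unfolding comp_def by fast
        show "D = C" if D: "D \<subseteq> C" "D \<noteq> {}" "\<forall>j\<in>J' C. l j \<in> D \<longleftrightarrow> r j \<in> D" for D
        proof -
          \<comment> \<open>For \<open>j\<close> outside \<open>J' C\<close> both \<open>l j\<close>
            and \<open>r j\<close> are outside \<open>C\<close>, hence outside
            \<open>D\<close>.\<close>
          have "\<forall>j\<in>J. l j \<in> D \<longleftrightarrow> r j \<in> D"
            using D S(3)[OF FC(2)] by (auto simp: J'_def)
          then show ?thesis
            using D kite_component_minimal 2 unfolding comp_def by metis
        qed
      qed (use J' FC in auto)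
    qed
  qed
  moreover have "subdirect_product (kite I J l r A) S K"
  proof (rule subdirect_productI)
    fix s assume s: "s \<in> S"
    obtain F C where FC: "s = (F, C)" "(F, C) \<in> S"
      using s by (cases s) auto
    note S' = S[OF FC(2)]
    show "h s \<in> bl_hom (kite I J l r A) (K s)"
      unfolding h_def K_def FC fst_conv snd_conv
      using S' assms basic[OF FC(2)] filter_class_hom[OF S'(1)]
      by (intro kite_map_hom) (auto simp: J'_def)
    have "J' C \<subseteq> J"
      by (auto simp: J'_def)
    then show "carrier (K s) \<subseteq> h s ` carrier (kite I J l r A)"
      unfolding h_def K_def FC fst_conv snd_conv kite_simps
      using S' pseudo_hoop_axioms filter_class_image[OF S'(1)] by (intro kite_map_surj)
  next
    have sep: "\<exists>F. (\<exists>c. monolithic_filter F c) \<and> filter_class A F a \<noteq> filter_class A F b"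
      if ab: "a \<in> carrier A" "b \<in> carrier A" "a \<noteq> b" for a b
    proof -
      \<comment> \<open>Distinct elements cannot have both differences equal to
        \<open>\<one>\<close>. A filter avoiding a nontrivial difference separates the classes,
        since equal classes would put both differences into it.\<close>
      obtain c where c: "c \<in> carrier A" "c \<noteq> \<one>\<^bsub>A\<^esub>" "c = a \<setminus>\<^bsub>A\<^esub> b \<or> c = b \<setminus>\<^bsub>A\<^esub> a"
        using ab by (metis hoop_le_antisym hoop_le_def ldiv_closed)
      then obtain F where F: "monolithic_filter F c"
        using monolithic_filter_exists by blast
      then have "c \<notin> F" "normal_filter A F"
        by (simp_all add: monolithic_filter_def)
      then have "filter_class A F a \<noteq> filter_class A F b"
        using c ab by (auto simp: filter_class_eq_iff)
      then show ?thesis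
        using F by blast
    qed
    fix x y assume x: "x \<in> carrier (kite I J l r A)" and y: "y \<in> carrier (kite I J l r A)"
      and "x \<noteq> y"
    \<comment> \<open>\<open>kite_map\<close> keeps barred and unbarred elements apart, so the pair
      \<open>(carrier A, {})\<close> suffices.\<close>
    have mixed: "\<exists>s\<in>S. h s (Inl f) \<noteq> h s (Inr a)" "\<exists>s\<in>S. h s (Inr a) \<noteq> h s (Inl f)" for f a
      by (auto simp: S_def h_def kite_map_def)
    show "\<exists>s\<in>S. h s x \<noteq> h s y"
    proof (cases x; cases y)
      fix a b assume ab: "x = Inr a" "y = Inr b"
      have carr: "a \<in> I \<rightarrow>\<^sub>E carrier A" "b \<in> I \<rightarrow>\<^sub>E carrier A" "a \<noteq> b"
        using x y ab \<open>x \<noteq> y\<close> by (simp_all add: kite_simps kite_carrier_simps)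
      then obtain i where i: "i \<in> I" "a i \<noteq> b i"
        by (metis PiE_ext)
      then obtain F where F: "\<exists>c. monolithic_filter F c"
          "filter_class A F (a i) \<noteq> filter_class A F (b i)"
        using sep carr by (meson PiE_mem)
      have "i \<in> comp i"
        using i by (simp add: comp_def kite_component_self)
      then have "h (F, comp i) x \<noteq> h (F, comp i) y"
        using F(2) ab by (auto simp: h_def kite_map_def dest!: fun_cong[of _ _ i])
      then show ?thesis
        using F(1) i unfolding S_def by blast
    next
      fix f g assume fg: "x = Inl f" "y = Inl g"
      have carr: "f \<in> J \<rightarrow>\<^sub>E carrier A" "g \<in> J \<rightarrow>\<^sub>E carrier A" "f \<noteq> g"
        using x y fg \<open>x \<noteq> y\<close> by (simp_all add: kite_simps kite_carrier_simps)
      then obtain j where j: "j \<in> J" "f j \<noteq> g j"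
        by (metis PiE_ext)
      then obtain F where F: "\<exists>c. monolithic_filter F c"
          "filter_class A F (f j) \<noteq> filter_class A F (g j)"
        using sep carr by (meson PiE_mem)
      \<comment> \<open>A barred coordinate \<open>j\<close> survives in the factor over the
        component of \<open>l j\<close>.\<close>
      have lj: "l j \<in> I"
        using j assms(3) by blast
      then have "j \<in> J' (comp (l j))"
        using j by (simp add: comp_def kite_component_self J'_def)
      then have "h (F, comp (l j)) x \<noteq> h (F, comp (l j)) y"
        using F(2) fg by (auto simp: h_def kite_map_def dest!: fun_cong[of _ _ j])
      then show ?thesis
        using F(1) lj unfolding S_def by blast
    qed (use mixed in auto)
  qed
  ultimately show ?thesis
    by blast
qed

end
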